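(* Let $k\geq 3$ and $1\leq d\leq k-2$. Let $X_{k,d}^1$ be the set consisting of the pattern $321$ together with the patterns $$(d+1,d+2,\dots,k-1,\,1,2,\dots,j,\,k,\,j+1,j+2,\dots,d),\qquad j=0,1,\dots,d,$$ and let $x_{k,d}^1(n)$ be the number of permutations in $S_n$ avoiding every pattern in $X_{k,d}^1$. Then for all $n\geq k$, $$\sum_{j=0}^{k-1}(-1)^j\binom{k-1-j}{j}x_{k,d}^1(n-j)=\binom{n-d-1}{k-d-2},$$ for all $0\leq n\leq k-1$, $x_{k,d}^1(n)=\frac{1}{n+1}\binom{2n}{n}$, and $$\sum_{n\geq0}x_{k,d}^1(n)x^n=\dfrac{U_{k-2}\left(\frac{1}{2\sqrt{x}}\right)+\frac{x^{k/2}}{(1-x)^{k-d-1}}}{\sqrt{x}\,U_{k-1}\left(\frac{1}{2\sqrt{x}}\right)}.$$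
   Context: A permutation $\alpha\in S_n$ contains a pattern $\tau\in S_m$ if there are indices $i_1<\dots<i_m$ with $(\alpha_{i_1},\dots,\alpha_{i_m})$ order-isomorphic to $\tau$; otherwise it avoids $\tau$. $U_m$ is the Chebyshev polynomial of the second kind, $U_m(\cos\theta)=\sin((m+1)\theta)/\sin\theta$. *)

theory Defs
  imports
    "HOL-Combinatorics.Multiset_Permutations"
    "HOL-Computational_Algebra.Computational_Algebra"
begin

(* Permutations and patterns are lists in one-line notation; S_n is
   permutations_of_set {1..n}. *)

definition contains_pattern :: "nat list \<Rightarrow> nat list \<Rightarrow> bool" where
  "contains_pattern \<alpha> \<tau> \<longleftrightarrow>
     (\<exists>i :: nat \<Rightarrow> nat.
        strict_mono_on {..<length \<tau>} i \<and>
        (\<forall>r<length \<tau>. i r < length \<alpha>) \<and>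
        (\<forall>r<length \<tau>. \<forall>s<length \<tau>. \<alpha> ! i r < \<alpha> ! i s \<longleftrightarrow> \<tau> ! r < \<tau> ! s))"

definition avoids_pattern :: "nat list \<Rightarrow> nat list \<Rightarrow> bool" where
  "avoids_pattern \<alpha> \<tau> \<longleftrightarrow> \<not> contains_pattern \<alpha> \<tau>"

definition X1_pattern :: "nat \<Rightarrow> nat \<Rightarrow> nat \<Rightarrow> nat list" where
  "X1_pattern k d j = [d + 1..<k] @ [1..<j + 1] @ [k] @ [j + 1..<d + 1]"

definition X1 :: "nat \<Rightarrow> nat \<Rightarrow> nat list set" where
  "X1 k d = insert [3, 2, 1] (X1_pattern k d ` {0..d})"

definition x1 :: "nat \<Rightarrow> nat \<Rightarrow> nat \<Rightarrow> nat" where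
  "x1 k d n = card {\<alpha> \<in> permutations_of_set {1..n}. \<forall>\<tau>\<in>X1 k d. avoids_pattern \<alpha> \<tau>}"

definition chebyshev_U :: "nat \<Rightarrow> real poly" where
  "chebyshev_U m =
     (THE p. \<forall>\<theta>. sin \<theta> \<noteq> 0 \<longrightarrow> poly p (cos \<theta>) = sin (real (m + 1) * \<theta>) / sin \<theta>)"

lemma chebyshev_U_exists:
  "\<exists>p :: real poly. \<forall>\<theta>. sin \<theta> \<noteq> 0 \<longrightarrow> poly p (cos \<theta>) = sin (real (m + 1) * \<theta>) / sin \<theta>"
proof (induction m rule: less_induct)
  case (less m)
  consider "m = 0" | "m = 1" | l where "m = Suc (Suc l)"
    by (metis One_nat_def not0_implies_Suc)
  then show ?case
  proof cases
    case 1
    then show ?thesis by (intro exI[of _ 1]) simp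
  next
    case 2
    then show ?thesis by (intro exI[of _ "[:0, 2:]"]) (auto simp: sin_double)
  next
    case (3 l)
    obtain p where p: "\<And>\<theta>. sin \<theta> \<noteq> 0 \<Longrightarrow> poly p (cos \<theta>) = sin (real (l + 1) * \<theta>) / sin \<theta>"
      using less[of l] 3 by auto
    obtain q where q: "\<And>\<theta>. sin \<theta> \<noteq> 0 \<Longrightarrow> poly q (cos \<theta>) = sin (real (Suc l + 1) * \<theta>) / sin \<theta>"
      using less[of "Suc l"] 3 by auto
    have "poly ([:0, 2:] * q - p) (cos \<theta>) = sin (real (m + 1) * \<theta>) / sin \<theta>"
      if "sin \<theta> \<noteq> 0" for \<theta>
    proof -
      define a where "a = real (Suc l + 1) * \<theta>"
      have l: "real (l + 1) * \<theta> = a - \<theta>" and m: "real (m + 1) * \<theta> = a + \<theta>"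
        by (simp_all add: a_def 3 algebra_simps)
      have P: "poly p (cos \<theta>) = sin (a - \<theta>) / sin \<theta>"
        using p[OF that] by (simp only: l)
      have Q: "poly q (cos \<theta>) = sin a / sin \<theta>"
        using q[OF that] by (simp only: a_def)
      have "poly ([:0, 2:] * q - p) (cos \<theta>) = (2 * cos \<theta> * sin a - sin (a - \<theta>)) / sin \<theta>"
        by (simp add: P Q diff_divide_distrib)
      also have "2 * cos \<theta> * sin a - sin (a - \<theta>) = sin (a + \<theta>)"
        by (simp add: sin_add sin_diff)
      finally show ?thesis
        by (simp only: m)
    qed
    then show ?thesis by blast
  qed
qed

lemma poly_eq_on_cos:
  fixes p q :: "real poly"
  assumes "\<And>\<theta>. sin \<theta> \<noteq> 0 \<Longrightarrow> poly p (cos \<theta>) = poly q (cos \<theta>)"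
  shows "p = q"
proof (rule ccontr)
  assume "p \<noteq> q"
  then have "finite {x. poly (p - q) x = 0}"
    by (intro poly_roots_finite) simp
  moreover have "{-1<..<1::real} \<subseteq> {x. poly (p - q) x = 0}"
  proof
    fix x :: real
    assume "x \<in> {-1<..<1}"
    then have "cos (arccos x) = x" and "sin (arccos x) \<noteq> 0"
      by (auto intro: cos_arccos dest: sin_arccos_nonzero)
    then show "x \<in> {x. poly (p - q) x = 0}"
      using assms[of "arccos x"] by simp
  qed
  ultimately have "finite {-1<..<1::real}"
    by (rule rev_finite_subset)
  then show False
    using infinite_Ioo[of "-1::real" 1] by simp
qed

lemma poly_chebyshev_U_cos:
  assumes "sin \<theta> \<noteq> 0"
  shows "poly (chebyshev_U m) (cos \<theta>) = sin (real (m + 1) * \<theta>) / sin \<theta>"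
proof -
  have "\<exists>!p :: real poly.
      \<forall>\<theta>. sin \<theta> \<noteq> 0 \<longrightarrow> poly p (cos \<theta>) = sin (real (m + 1) * \<theta>) / sin \<theta>"
    using chebyshev_U_exists[of m] by (rule ex_ex1I) (rule poly_eq_on_cos, simp)
  from theI'[OF this] show ?thesis
    unfolding chebyshev_U_def using assms by blast
qed

(* The generating function identity involves sqrt x and negative powers of it, so it is
   read in the field of formal Laurent series in the variable sqrt x (fls_X). *)

definition chebyshev_U_fls :: "nat \<Rightarrow> real fls \<Rightarrow> real fls" where
  "chebyshev_U_fls m f = poly (map_poly fls_const (chebyshev_U m)) f"

definition x1_gf :: "nat \<Rightarrow> nat \<Rightarrow> real fps" where
  "x1_gf k d = Abs_fps (\<lambda>n. real (x1 k d n))"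

end

theory Submission imports Defs "HOL-Library.Sublist" begin

text \<open>
  Put \<open>l = k - d - 1\<close>. A 321-avoiding permutation contains one of the long patterns iff it has an
  increasing subsequence of \<open>l\<close> entries followed by \<open>d\<close> smaller entries and, somewhere behind it, an
  entry exceeding all of these. Let \<open>A i m n\<close> count the permutations of length \<open>n\<close> in the class whose
  first \<open>i\<close> entries are increasing and larger than \<open>m\<close> and in which \<open>1, \<dots>, m\<close> occur in increasing
  order. For \<open>i \<le> l\<close> and \<open>m \<le> d\<close>, deleting a first entry \<open>m + 1\<close> gives
  \<open>A i m n = A i (m+1) n + A (i-1) m (n-1)\<close>, and deleting a 1 in position \<open>i + 1\<close> gives
  \<open>A i m n = A (i+1) m n + A i (m-1) (n-1)\<close>. Hence, for \<open>n \<ge> i + m\<close>,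
  \<open>A i m n\<close> depends on \<open>i + m\<close> and \<open>n\<close> only and is
  the coefficient of \<open>x\<^sup>n\<close> in \<open>G\<^bsub>i+m\<^esub> X\<close>, where \<open>X\<close> is the generating function of the class and
  \<open>G\<^bsub>m+2\<^esub> = G\<^bsub>m+1\<^esub> - x G\<^bsub>m\<^esub>\<close>. At \<open>i = l\<close>, \<open>m = d\<close> the \<open>l\<close>-th entry must be \<open>n\<close> and everything behind
  it increases, so \<open>A l d n\<close> is a binomial coefficient.
\<close>

section \<open>Containment as a subsequence property\<close>

lemma subseq_imp_index:
  assumes "subseq \<sigma> \<alpha>"
  shows "\<exists>i. strict_mono_on {..<length \<sigma>} i \<and> (\<forall>r<length \<sigma>. i r < length \<alpha> \<and> \<alpha> ! i r = \<sigma> ! r)"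
  using assms
proof (induction rule: list_emb.induct)
  case (list_emb_Nil ys)
  then show ?case by (auto simp: strict_mono_on_def)
next
  case (list_emb_Cons xs ys y)
  then obtain i where "strict_mono_on {..<length xs} i"
    "\<forall>r<length xs. i r < length ys \<and> ys ! i r = xs ! r" by blast
  then show ?case
    by (intro exI[of _ "\<lambda>r. Suc (i r)"]) (auto simp: strict_mono_on_def)
next
  case (list_emb_Cons2 x y xs ys)
  then obtain i where i: "strict_mono_on {..<length xs} i"
    "\<forall>r<length xs. i r < length ys \<and> ys ! i r = xs ! r" by blast
  then show ?case using \<open>x = y\<close>
    by (intro exI[of _ "\<lambda>r. case r of 0 \<Rightarrow> 0 | Suc q \<Rightarrow> Suc (i q)"])
      (auto simp: strict_mono_on_def split: nat.splits simp: nth_Cons)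
qed

lemma index_imp_subseq:
  assumes "strict_mono_on {..<length \<sigma>} i" "\<forall>r<length \<sigma>. i r < length \<alpha> \<and> \<alpha> ! i r = \<sigma> ! r"
  shows "subseq \<sigma> \<alpha>"
  using assms
proof (induction \<sigma> arbitrary: \<alpha> i)
  case Nil
  then show ?case by simp
next
  case (Cons x \<sigma>)
  have gt: "i 0 < i (Suc r)" if "r < length \<sigma>" for r
    using Cons.prems(1) that by (auto simp: strict_mono_on_def)
  \<comment> \<open>The head of the word uses position \<open>i 0\<close> and all later indices are
    larger, so the tail embeds behind that position once the indices are shifted down by
    \<open>Suc (i 0)\<close>.\<close>
  have "subseq \<sigma> (drop (Suc (i 0)) \<alpha>)"
  proof (rule Cons.IH)
    show "strict_mono_on {..<length \<sigma>} (\<lambda>r. i (Suc r) - Suc (i 0))"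
      using Cons.prems(1) gt unfolding strict_mono_on_def
      by (auto intro!: diff_less_mono simp: Suc_le_eq)
    show "\<forall>r<length \<sigma>. i (Suc r) - Suc (i 0) < length (drop (Suc (i 0)) \<alpha>) \<and>
            drop (Suc (i 0)) \<alpha> ! (i (Suc r) - Suc (i 0)) = \<sigma> ! r"
    proof (intro allI impI)
      fix r assume r: "r < length \<sigma>"
      then have "i (Suc r) < length \<alpha> \<and> \<alpha> ! i (Suc r) = \<sigma> ! r"
        using Cons.prems(2)[rule_format, of "Suc r"] by simp
      with gt[OF r] show "i (Suc r) - Suc (i 0) < length (drop (Suc (i 0)) \<alpha>) \<and>
            drop (Suc (i 0)) \<alpha> ! (i (Suc r) - Suc (i 0)) = \<sigma> ! r"
        by (auto simp: Suc_le_eq)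
    qed
  qed
  then have "subseq (x # \<sigma>) (\<alpha> ! i 0 # drop (Suc (i 0)) \<alpha>)"
    using Cons.prems(2) by auto
  then have "subseq (x # \<sigma>) (take (i 0) \<alpha> @ \<alpha> ! i 0 # drop (Suc (i 0)) \<alpha>)"
    by (simp add: list_emb_append2)
  then show ?case
    using Cons.prems(2) id_take_nth_drop[of "i 0" \<alpha>] by simp
qed

lemma contains_pattern_iff_subseq:
  "contains_pattern \<alpha> \<tau> \<longleftrightarrow>
     (\<exists>\<sigma>. subseq \<sigma> \<alpha> \<and> length \<sigma> = length \<tau> \<and>
        (\<forall>r<length \<tau>. \<forall>s<length \<tau>. \<sigma> ! r < \<sigma> ! s \<longleftrightarrow> \<tau> ! r < \<tau> ! s))" (is "?L \<longleftrightarrow> ?R")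
proof
  assume ?L
  then obtain i where i: "strict_mono_on {..<length \<tau>} i" "\<forall>r<length \<tau>. i r < length \<alpha>"
    "\<forall>r<length \<tau>. \<forall>s<length \<tau>. \<alpha> ! i r < \<alpha> ! i s \<longleftrightarrow> \<tau> ! r < \<tau> ! s"
    unfolding contains_pattern_def by blast
  then show ?R
    by (intro exI[of _ "map (\<lambda>r. \<alpha> ! i r) [0..<length \<tau>]"])
      (auto intro!: index_imp_subseq[where i = i])
next
  assume ?R
  then obtain \<sigma> where \<sigma>: "subseq \<sigma> \<alpha>" "length \<sigma> = length \<tau>"
    "\<forall>r<length \<tau>. \<forall>s<length \<tau>. \<sigma> ! r < \<sigma> ! s \<longleftrightarrow> \<tau> ! r < \<tau> ! s" by blast
  from subseq_imp_index[OF \<sigma>(1)] obtain i where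
    "strict_mono_on {..<length \<sigma>} i" "\<forall>r<length \<sigma>. i r < length \<alpha> \<and> \<alpha> ! i r = \<sigma> ! r" by blast
  with \<sigma>(2,3) show ?L
    unfolding contains_pattern_def by (intro exI[of _ i]) auto
qed

text \<open>For \<open>l = k - 1 - d\<close> this is containment of some \<open>X1_pattern k d j\<close>; here \<open>j = length ys\<close>.\<close>
definition has_X1 :: "nat \<Rightarrow> nat \<Rightarrow> nat list \<Rightarrow> bool" where
  "has_X1 l d \<alpha> \<longleftrightarrow> (\<exists>xs ys w zs. subseq (xs @ ys @ w # zs) \<alpha> \<and> length xs = l \<and>
     length ys + length zs = d \<and> sorted_wrt (<) (ys @ zs @ xs @ [w]))"

definition no321 :: "nat list \<Rightarrow> bool" where
  "no321 \<alpha> \<longleftrightarrow> (\<forall>x y z. subseq [x, y, z] \<alpha> \<longrightarrow> z < y \<longrightarrow> y < x \<longrightarrow> False)"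

section \<open>The forbidden patterns as conditions on subsequences\<close>

lemma avoids_321_iff: "avoids_pattern \<alpha> [3, 2, 1] \<longleftrightarrow> no321 \<alpha>"
proof -
  have "contains_pattern \<alpha> [3, 2, 1] \<longleftrightarrow> (\<exists>x y z. subseq [x, y, z] \<alpha> \<and> z < y \<and> y < x)"
    unfolding contains_pattern_iff_subseq
  proof (intro iffI; elim exE conjE)
    fix \<sigma> assume a: "subseq \<sigma> \<alpha>" "length \<sigma> = length [3, 2, 1::nat]"
      "\<forall>r<length [3, 2, 1::nat]. \<forall>s<length [3, 2, 1::nat]. (\<sigma> ! r < \<sigma> ! s) = ([3, 2, 1::nat] ! r < [3, 2, 1] ! s)"
    from a(2) obtain x y z where s: "\<sigma> = [x, y, z]"
      by (auto simp: length_Suc_conv eval_nat_numeral)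
    have "z < y" using a(3)[rule_format, of 2 1] by (simp add: s)
    moreover have "y < x" using a(3)[rule_format, of 1 0] by (simp add: s)
    ultimately show "\<exists>x y z. subseq [x, y, z] \<alpha> \<and> z < y \<and> y < x" using a(1) s by blast
  next
    fix x y z assume "subseq [x, y, z] \<alpha>" "z < y" "y < x"
    then show "\<exists>\<sigma>. subseq \<sigma> \<alpha> \<and> length \<sigma> = length [3, 2, 1::nat] \<and>
      (\<forall>r<length [3, 2, 1::nat]. \<forall>s<length [3, 2, 1::nat]. (\<sigma> ! r < \<sigma> ! s) = ([3, 2, 1::nat] ! r < [3, 2, 1] ! s))"
      by (intro exI[of _ "[x, y, z]"]) (auto simp: less_Suc_eq)
  qed
  then show ?thesis unfolding avoids_pattern_def no321_def by blast
qed

text \<open>Order isomorphism depends only on the set of pairs of corresponding entries. Hence both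
  words may be rearranged by the same permutation of positions.\<close>

lemma same_order_iff_zip:
  assumes "length \<sigma> = length \<tau>"
  shows "(\<forall>r<length \<tau>. \<forall>s<length \<tau>. \<sigma> ! r < \<sigma> ! s \<longleftrightarrow> \<tau> ! r < \<tau> ! s) \<longleftrightarrow>
    (\<forall>(a, b)\<in>set (zip \<sigma> \<tau>). \<forall>(a', b')\<in>set (zip \<sigma> \<tau>). a < a' \<longleftrightarrow> b < b')"
proof -
  have "set (zip \<sigma> \<tau>) = (\<lambda>r. (\<sigma> ! r, \<tau> ! r)) ` {..<length \<tau>}"
    using assms by (auto simp: set_zip)
  then show ?thesis by simp (metis lessThan_iff)
qed

lemma same_order_upt:
  assumes "length (\<sigma> :: nat list) = n"
  shows "(\<forall>(a, b)\<in>set (zip \<sigma> [1..<Suc n]). \<forall>(a', b')\<in>set (zip \<sigma> [1..<Suc n]). a < a' \<longleftrightarrow> b < b')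
    \<longleftrightarrow> sorted_wrt (<) \<sigma>"
proof -
  have "(\<forall>r<n. \<forall>s<n. \<sigma> ! r < \<sigma> ! s \<longleftrightarrow> [1..<Suc n] ! r < [1..<Suc n] ! s) \<longleftrightarrow> sorted_wrt (<) \<sigma>"
  proof
    assume "\<forall>r<n. \<forall>s<n. \<sigma> ! r < \<sigma> ! s \<longleftrightarrow> [1..<Suc n] ! r < [1..<Suc n] ! s"
    then show "sorted_wrt (<) \<sigma>"
      using assms by (auto simp: sorted_wrt_iff_nth_less simp del: upt_Suc)
  next
    assume "sorted_wrt (<) \<sigma>"
    then have *: "r < s \<Longrightarrow> s < n \<Longrightarrow> \<sigma> ! r < \<sigma> ! s" for r s
      using assms by (auto simp: sorted_wrt_iff_nth_less)
    have "\<sigma> ! r < \<sigma> ! s \<longleftrightarrow> r < s" if "r < n" "s < n" for r s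
      using *[of r s] *[of s r] that by (cases r s rule: linorder_cases) auto
    then show "\<forall>r<n. \<forall>s<n. \<sigma> ! r < \<sigma> ! s \<longleftrightarrow> [1..<Suc n] ! r < [1..<Suc n] ! s"
      by (auto simp del: upt_Suc)
  qed
  then show ?thesis
    using same_order_iff_zip[of \<sigma> "[1..<Suc n]"] assms by (simp del: upt_Suc)
qed

lemma length_X1_pattern: "j \<le> d \<Longrightarrow> d < k \<Longrightarrow> length (X1_pattern k d j) = k"
  by (simp add: X1_pattern_def del: upt_Suc)

text \<open>Moving the blocks of the pattern into the order 1, ..., k turns the word into
  \<open>ys @ zs @ xs @ [w]\<close> without changing the set of pairs. What remains is order
  isomorphism with the identity, which \<open>same_order_upt\<close> identifies with being strictly
  increasing.\<close>

lemma X1_pattern_order: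
  fixes xs ys zs :: "nat list"
  assumes "length xs = k - 1 - d" "length ys = j" "length zs = d - j" "j \<le> d" "d < k"
  shows "(\<forall>r<k. \<forall>s<k. (xs @ ys @ w # zs) ! r < (xs @ ys @ w # zs) ! s \<longleftrightarrow>
            X1_pattern k d j ! r < X1_pattern k d j ! s) \<longleftrightarrow>
    sorted_wrt (<) (ys @ zs @ xs @ [w])"
proof -
  have "[1..<Suc k] = [1..<j + 1] @ [j + 1..<d + 1] @ [d + 1..<k] @ [k]"
    using assms upt_add_eq_append[of 1 "j + 1" "d - j"] upt_add_eq_append[of 1 "d + 1" "k - (d + 1)"]
    by simp
  then have "zip (ys @ zs @ xs @ [w]) [1..<Suc k] =
     zip ys [1..<j + 1] @ zip zs [j + 1..<d + 1] @ zip xs [d + 1..<k] @ [(w, k)]"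
    using assms by (simp del: upt_Suc)
  moreover have "zip (xs @ ys @ w # zs) (X1_pattern k d j) =
     zip xs [d + 1..<k] @ zip ys [1..<j + 1] @ (w, k) # zip zs [j + 1..<d + 1]"
    using assms by (simp add: X1_pattern_def del: upt_Suc)
  ultimately have "set (zip (xs @ ys @ w # zs) (X1_pattern k d j)) =
      set (zip (ys @ zs @ xs @ [w]) [1..<Suc k])"
    by (simp only: set_append list.set) blast
  moreover have "length (X1_pattern k d j) = k"
    using assms by (simp add: length_X1_pattern)
  ultimately show ?thesis
    using same_order_iff_zip[of "xs @ ys @ w # zs" "X1_pattern k d j"]
      same_order_upt[of "ys @ zs @ xs @ [w]" k] assms by simp
qed

lemma contains_X1_iff:
  assumes "d < k"
  shows "(\<exists>j\<in>{0..d}. contains_pattern \<alpha> (X1_pattern k d j)) \<longleftrightarrow> has_X1 (k - 1 - d) d \<alpha>" (is "?L \<longleftrightarrow> ?R")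
proof
  assume ?L
  then obtain j \<sigma> where j: "j \<le> d" and \<sigma>: "subseq \<sigma> \<alpha>" "length \<sigma> = length (X1_pattern k d j)"
    "\<forall>r<length (X1_pattern k d j). \<forall>s<length (X1_pattern k d j).
      \<sigma> ! r < \<sigma> ! s \<longleftrightarrow> X1_pattern k d j ! r < X1_pattern k d j ! s"
    unfolding contains_pattern_iff_subseq by auto
  have len: "length (X1_pattern k d j) = k"
    using assms j by (simp add: length_X1_pattern)
  define l where "l = k - 1 - d"
  \<comment> \<open>The cuts follow the blocks of \<open>X1_pattern k d j\<close>: the
    \<open>l\<close> letters \<open>d + 1\<close>, ..., \<open>k - 1\<close>, then 1, ...,
    \<open>j\<close>, then the letter \<open>k\<close>, then the rest.\<close>
  define xs ys w zs where "xs = take l \<sigma>" and "ys = take j (drop l \<sigma>)" and "w = \<sigma> ! (l + j)"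
    and "zs = drop (Suc (l + j)) \<sigma>"
  have lt: "l + j < length \<sigma>" using \<sigma>(2) len assms j by (simp add: l_def)
  have "\<sigma> = take (l + j) \<sigma> @ w # zs"
    unfolding w_def zs_def by (rule id_take_nth_drop[OF lt])
  then have eq: "\<sigma> = xs @ ys @ w # zs"
    by (simp add: xs_def ys_def take_add)
  have L: "length xs = l" "length ys = j" "length zs = d - j"
    using lt \<sigma>(2) len assms j by (auto simp: xs_def ys_def zs_def l_def)
  have "sorted_wrt (<) (ys @ zs @ xs @ [w])"
    using X1_pattern_order[of xs k d ys j zs w] L \<sigma>(3) eq len assms j by (simp add: l_def)
  with eq L \<sigma>(1) j show ?R unfolding has_X1_def l_def[symmetric]
    by (intro exI[of _ xs] exI[of _ ys] exI[of _ w] exI[of _ zs]) auto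
next
  assume ?R
  then obtain xs ys w zs where s: "subseq (xs @ ys @ w # zs) \<alpha>" "length xs = k - 1 - d"
    "length ys + length zs = d" "sorted_wrt (<) (ys @ zs @ xs @ [w])"
    unfolding has_X1_def by blast
  have len: "length (X1_pattern k d (length ys)) = k"
    using assms s(3) by (simp add: length_X1_pattern)
  have "contains_pattern \<alpha> (X1_pattern k d (length ys))"
    unfolding contains_pattern_iff_subseq len
    using X1_pattern_order[of xs k d ys "length ys" zs w] s assms
    by (intro exI[of _ "xs @ ys @ w # zs"]) auto
  then show ?L using s(3) by auto
qed

definition avoiders :: "nat \<Rightarrow> nat \<Rightarrow> nat \<Rightarrow> nat list set" where
  "avoiders l d n = {\<alpha> \<in> permutations_of_set {1..n}. no321 \<alpha> \<and> \<not> has_X1 l d \<alpha>}"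

lemma x1_eq_card_avoiders:
  assumes "d < k"
  shows "x1 k d n = card (avoiders (k - 1 - d) d n)"
proof -
  have "(\<forall>\<tau>\<in>X1 k d. avoids_pattern \<alpha> \<tau>) \<longleftrightarrow> no321 \<alpha> \<and> \<not> has_X1 (k - 1 - d) d \<alpha>" for \<alpha>
    using contains_X1_iff[OF assms, of \<alpha>] avoids_321_iff[of \<alpha>]
    by (auto simp: X1_def avoids_pattern_def)
  then show ?thesis by (simp add: x1_def avoiders_def)
qed

section \<open>Inserting a letter\<close>

lemma subseq_mapD: "subseq \<sigma> (map f \<gamma>) \<Longrightarrow> \<exists>\<sigma>'. subseq \<sigma>' \<gamma> \<and> \<sigma> = map f \<sigma>'"
  by (auto simp: subseq_conv_nths nths_map)

lemma sorted_wrt_subseq: "subseq xs ys \<Longrightarrow> sorted_wrt P ys \<Longrightarrow> sorted_wrt P xs"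
  by (induction rule: list_emb.induct) (auto dest: list_emb_set)

lemma subseq_insertD:
  assumes "subseq \<sigma> (us @ a # vs)"
  shows "subseq \<sigma> (us @ vs) \<or> (\<exists>\<sigma>1 \<sigma>2. \<sigma> = \<sigma>1 @ a # \<sigma>2 \<and> subseq \<sigma>1 us \<and> subseq \<sigma>2 vs)"
proof -
  from assms obtain \<sigma>1 \<sigma>' where s: "\<sigma> = \<sigma>1 @ \<sigma>'" "subseq \<sigma>1 us" "subseq \<sigma>' (a # vs)"
    by (auto elim: subseq_appendE)
  show ?thesis
  proof (cases "subseq \<sigma>' vs")
    case True
    then show ?thesis using s by (auto intro: list_emb_append_mono)
  next
    case False
    then obtain \<sigma>2 where "\<sigma>' = a # \<sigma>2" "subseq \<sigma>2 vs"
      using s(3) by (cases \<sigma>') (auto split: if_splits)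
    then show ?thesis using s by blast
  qed
qed

section \<open>Forbidden patterns under deletion, relabelling and insertion of a letter\<close>

lemma no321_subseq: "no321 \<alpha> \<Longrightarrow> subseq \<beta> \<alpha> \<Longrightarrow> no321 \<beta>"
  unfolding no321_def using subseq_order.trans by blast

lemma has_X1_subseq: "has_X1 l d \<beta> \<Longrightarrow> subseq \<beta> \<alpha> \<Longrightarrow> has_X1 l d \<alpha>"
  unfolding has_X1_def using subseq_order.trans by blast

lemma no321_map:
  assumes "strict_mono (f :: nat \<Rightarrow> nat)"
  shows "no321 (map f \<gamma>) \<longleftrightarrow> no321 \<gamma>"
proof
  assume "no321 (map f \<gamma>)"
  moreover have "subseq [f x, f y, f z] (map f \<gamma>)" if "subseq [x, y, z] \<gamma>" for x y z
    using subseq_map[OF that, of f] by simp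
  ultimately show "no321 \<gamma>"
    unfolding no321_def using strict_mono_less[OF assms] by blast
next
  assume "no321 \<gamma>"
  then show "no321 (map f \<gamma>)"
    unfolding no321_def using strict_mono_less[OF assms] by (auto dest!: subseq_mapD)
qed

lemma has_X1_map:
  assumes "strict_mono (f :: nat \<Rightarrow> nat)"
  shows "has_X1 l d (map f \<gamma>) \<longleftrightarrow> has_X1 l d \<gamma>"
proof
  assume "has_X1 l d (map f \<gamma>)"
  then obtain xs ys w zs where s: "subseq (xs @ ys @ w # zs) (map f \<gamma>)" "length xs = l"
     "length ys + length zs = d" "sorted_wrt (<) (ys @ zs @ xs @ [w])"
    unfolding has_X1_def by blast
  from subseq_mapD[OF s(1)] obtain \<sigma> where \<sigma>: "subseq \<sigma> \<gamma>" "map f \<sigma> = xs @ ys @ w # zs" by metis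
  from iffD1[OF map_eq_append_conv \<sigma>(2)] obtain xs' r
    where r: "\<sigma> = xs' @ r" "xs = map f xs'" "ys @ w # zs = map f r"
    by (elim exE conjE) (rule that)
  from iffD1[OF map_eq_append_conv r(3)[symmetric]] obtain ys' r'
    where r': "r = ys' @ r'" "ys = map f ys'" "w # zs = map f r'"
    by (elim exE conjE) (rule that)
  from iffD1[OF map_eq_Cons_conv r'(3)[symmetric]] obtain w' zs'
    where w': "r' = w' # zs'" "f w' = w" "map f zs' = zs"
    by (elim exE conjE) (rule that)
  have "subseq (xs' @ ys' @ w' # zs') \<gamma>" using \<sigma>(1) r(1) r'(1) w'(1) by simp
  moreover have "sorted_wrt (<) (map f (ys' @ zs' @ xs' @ [w']))"
    using s(4) r(2) r'(2) w'(2,3) by simp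
  then have "sorted_wrt (<) (ys' @ zs' @ xs' @ [w'])"
    unfolding sorted_wrt_map using strict_mono_less[OF assms] by simp
  moreover have "length xs' = l" "length ys' + length zs' = d"
    using s(2,3) r(2) r'(2) w'(3) by auto
  ultimately show "has_X1 l d \<gamma>" unfolding has_X1_def by blast
next
  assume "has_X1 l d \<gamma>"
  then obtain xs ys w zs where s: "subseq (xs @ ys @ w # zs) \<gamma>" "length xs = l"
     "length ys + length zs = d" "sorted_wrt (<) (ys @ zs @ xs @ [w])"
    unfolding has_X1_def by blast
  have "subseq (map f xs @ map f ys @ f w # map f zs) (map f \<gamma>)"
    using subseq_map[OF s(1), of f] by simp
  moreover have "sorted_wrt (<) (map f (ys @ zs @ xs @ [w]))"
    unfolding sorted_wrt_map using s(4) strict_mono_less[OF assms] by simp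
  then have "sorted_wrt (<) (map f ys @ map f zs @ map f xs @ [f w])" by simp
  moreover have "length (map f xs) = l" "length (map f ys) + length (map f zs) = d"
    using s(2,3) by auto
  ultimately show "has_X1 l d (map f \<gamma>)" unfolding has_X1_def by blast
qed

text \<open>A new 321 must start at \<open>v\<close>, and its other two entries would form a descent
  among the letters below \<open>v\<close>.\<close>

lemma no321_Cons:
  assumes "no321 \<gamma>" "sorted_wrt (<) (filter (\<lambda>x. x < v) \<gamma>)"
  shows "no321 (v # \<gamma>)"
  unfolding no321_def
proof (intro allI impI)
  fix x y z assume s: "subseq [x, y, z] (v # \<gamma>)" "z < y" "y < x"
  show False
  proof (cases "subseq [x, y, z] \<gamma>")
    case True
    then show ?thesis using assms(1) s unfolding no321_def by blast
  next
    case False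
    then have "x = v" "subseq [y, z] \<gamma>" using s(1) by (auto split: if_splits)
    then have "subseq (filter (\<lambda>x. x < v) [y, z]) (filter (\<lambda>x. x < v) \<gamma>)"
      by (intro subseq_filter)
    then have "subseq [y, z] (filter (\<lambda>x. x < v) \<gamma>)" using s(2,3) \<open>x = v\<close> by simp
    then have "sorted_wrt (<) [y, z]" by (rule sorted_wrt_subseq) (rule assms(2))
    then show False using s by simp
  qed
qed

text \<open>Since \<open>xs\<close> is nonempty, an occurrence through the first letter
  \<open>v\<close> has \<open>v\<close> as the head of \<open>xs\<close>. The \<open>d\<close>
  entries of \<open>ys\<close> and \<open>zs\<close> are then distinct positive numbers below
  \<open>v\<close>, of which there are only \<open>v - 1 < d\<close>.\<close>

lemma has_X1_Cons:
  assumes "has_X1 l d (v # \<gamma>)" "0 \<notin> set \<gamma>" "1 \<le> v" "v \<le> d" "1 \<le> l"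
  shows "has_X1 l d \<gamma>"
proof -
  from assms(1) obtain xs ys w zs where s: "subseq (xs @ ys @ w # zs) (v # \<gamma>)" "length xs = l"
     "length ys + length zs = d" "sorted_wrt (<) (ys @ zs @ xs @ [w])"
    unfolding has_X1_def by blast
  from s(2) assms(5) obtain x xs' where xs: "xs = x # xs'" by (cases xs) auto
  show ?thesis
  proof (cases "subseq (xs @ ys @ w # zs) \<gamma>")
    case True
    then show ?thesis using s unfolding has_X1_def by blast
  next
    case False
    then have "x = v" and sub: "subseq (xs' @ ys @ w # zs) \<gamma>"
      using s(1) by (auto simp: xs split: if_splits)
    then have "set (ys @ zs) \<subseteq> {1..<v}"
    proof -
      have "y \<noteq> 0" if "y \<in> set (ys @ zs)" for y
        using that sub assms(2) list_emb_set[OF sub] by (metis Un_iff list.set_intros(2) set_append)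
      then show ?thesis using s(4) \<open>x = v\<close>
        by (auto simp: xs sorted_wrt_append Suc_le_eq)
    qed
    then have "card (set (ys @ zs)) \<le> v - 1"
      using card_mono[of "{1..<v}"] by simp
    moreover have "distinct (ys @ zs)"
      using s(4) by (force simp: sorted_wrt_append strict_sorted_iff)
    then have "card (set (ys @ zs)) = d"
      using s(3) by (metis distinct_card length_append)
    ultimately show ?thesis using assms(3,4) by linarith
  qed
qed

text \<open>The least letter can only be the last entry of a 321, so the other two entries would
  form a descent inside the increasing word \<open>us\<close>.\<close>

lemma no321_insert_least:
  assumes "no321 (us @ vs)" "\<forall>x\<in>set (us @ vs). v < x" "sorted_wrt (<) us"
  shows "no321 (us @ v # vs)"
  unfolding no321_def
proof (intro allI impI)
  fix x y z assume s: "subseq [x, y, z] (us @ v # vs)" "z < y" "y < x"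
  from subseq_insertD[OF s(1)] show False
  proof
    assume "subseq [x, y, z] (us @ vs)"
    then show ?thesis using assms(1) s unfolding no321_def by blast
  next
    assume "\<exists>\<sigma>1 \<sigma>2. [x, y, z] = \<sigma>1 @ v # \<sigma>2 \<and> subseq \<sigma>1 us \<and> subseq \<sigma>2 vs"
    then obtain \<sigma>1 \<sigma>2 where t: "[x, y, z] = \<sigma>1 @ v # \<sigma>2" "subseq \<sigma>1 us" "subseq \<sigma>2 vs" by blast
    have "\<forall>x\<in>set \<sigma>2. v < x" using list_emb_set[OF t(3)] assms(2) by (metis Un_iff set_append)
    then have "\<sigma>1 = [x, y]" using t(1) s(2,3)
      by (auto simp: Cons_eq_append_conv)
    then have "sorted_wrt (<) [x, y]" using t(2) assms(3) sorted_wrt_subseq by blast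
    then show False using s(3) by simp
  qed
qed

text \<open>Fewer than \<open>l\<close> letters precede \<open>v\<close>, so an occurrence through
  \<open>v\<close> has it inside the block \<open>xs\<close>. As \<open>d\<close> is positive, some
  entry of \<open>ys\<close> or \<open>zs\<close> is smaller than \<open>v\<close>, which
  contradicts the minimality of \<open>v\<close>.\<close>

lemma has_X1_insert_least:
  assumes "has_X1 l d (us @ v # vs)" "\<forall>x\<in>set (us @ vs). v < x" "length us < l" "1 \<le> d"
  shows "has_X1 l d (us @ vs)"
proof -
  from assms(1) obtain xs ys w zs where s: "subseq (xs @ ys @ w # zs) (us @ v # vs)" "length xs = l"
     "length ys + length zs = d" "sorted_wrt (<) (ys @ zs @ xs @ [w])"
    unfolding has_X1_def by blast
  from subseq_insertD[OF s(1)] show ?thesis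
  proof
    assume "subseq (xs @ ys @ w # zs) (us @ vs)"
    then show ?thesis using s unfolding has_X1_def by blast
  next
    assume "\<exists>\<sigma>1 \<sigma>2. xs @ ys @ w # zs = \<sigma>1 @ v # \<sigma>2 \<and> subseq \<sigma>1 us \<and> subseq \<sigma>2 vs"
    then obtain \<sigma>1 \<sigma>2 where t: "xs @ ys @ w # zs = \<sigma>1 @ v # \<sigma>2" "subseq \<sigma>1 us" by blast
    have "length \<sigma>1 < length xs" using list_emb_length[OF t(2)] s(2) assms(3) by simp
    then have "xs ! length \<sigma>1 = v" by (metis nth_append nth_append_length t(1))
    then have "v \<in> set xs" using \<open>length \<sigma>1 < length xs\<close> nth_mem by blast
    moreover obtain y where y: "y \<in> set (ys @ zs)" using s(3) assms(4) by (cases "ys @ zs") auto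
    ultimately have "y < v" using s(4) by (auto simp: sorted_wrt_append)
    moreover have "y \<in> set (us @ v # vs)" using y list_emb_set[OF s(1)]
      by (metis Un_iff list.set_intros(2) set_append)
    ultimately have False using assms(2) by (metis Un_iff less_asym set_append set_ConsD)
    then show ?thesis ..
  qed
qed

text \<open>Relabelling that makes room for a new letter \<open>v\<close>.\<close>
definition bump :: "nat \<Rightarrow> nat \<Rightarrow> nat" where
  "bump v x = (if x < v then x else Suc x)"

section \<open>Deleting a letter of a permutation and standardising the rest\<close>

lemma strict_mono_bump: "strict_mono (bump v)"
  by (auto simp: bump_def strict_mono_def)

lemma bump_image: "v \<in> {1..Suc n} \<Longrightarrow> bump v ` {1..n} = {1..Suc n} - {v}"
proof (intro equalityI subsetI)
  fix x assume "v \<in> {1..Suc n}" "x \<in> {1..Suc n} - {v}"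
  then show "x \<in> bump v ` {1..n}"
    by (intro image_eqI[of _ _ "if x < v then x else x - 1"]) (auto simp: bump_def)
qed (auto simp: bump_def)

lemma perm_insert:
  assumes "\<gamma> \<in> permutations_of_set {1..n}" "v \<in> {1..Suc n}" "us @ vs = map (bump v) \<gamma>"
  shows "us @ v # vs \<in> permutations_of_set {1..Suc n}"
proof -
  have \<gamma>: "set \<gamma> = {1..n}" "distinct \<gamma>" using assms(1) by (auto simp: permutations_of_set_def)
  have "set (us @ vs) = {1..Suc n} - {v}"
    using bump_image[OF assms(2)] \<gamma>(1) by (metis assms(3) set_map)
  moreover have "distinct (us @ vs)"
    unfolding assms(3) using \<gamma>(2) strict_mono_bump[of v]
    by (simp add: distinct_map strict_mono_imp_inj_on inj_on_subset)
  ultimately show ?thesis using assms(2) by (auto simp: permutations_of_set_def)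
qed

text \<open>The letters other than \<open>v\<close> are exactly the image of \<open>{1..n}\<close>
  under the injective map \<open>bump v\<close>, so the remaining word can be pulled back to a
  permutation.\<close>

lemma perm_delete:
  assumes "us @ v # vs \<in> permutations_of_set {1..Suc n}"
  obtains \<gamma> where "\<gamma> \<in> permutations_of_set {1..n}" "us @ vs = map (bump v) \<gamma>"
proof -
  have v: "v \<in> {1..Suc n}" and d: "distinct (us @ vs)" and s: "set (us @ vs) = {1..Suc n} - {v}"
    using assms by (auto simp: permutations_of_set_def)
  have "\<forall>y\<in>set (us @ vs). \<exists>x. y = bump v x"
    using s bump_image[OF v] by blast
  then obtain \<gamma> where \<gamma>: "us @ vs = map (bump v) \<gamma>"
    unfolding ex_map_conv[symmetric] by blast
  have "bump v ` set \<gamma> = bump v ` {1..n}"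
    using s bump_image[OF v] \<gamma> by (metis set_map)
  then have "set \<gamma> = {1..n}"
    using inj_image_eq_iff[OF strict_mono_imp_inj_on[OF strict_mono_bump]] by blast
  moreover have "distinct \<gamma>" using d unfolding \<gamma> by (simp add: distinct_map)
  ultimately show ?thesis using that \<gamma> by (auto simp: permutations_of_set_def)
qed

section \<open>The refined classes and their two recurrences\<close>

lemma sorted_wrt_subseqI: "(\<And>x y. subseq [x, y] xs \<Longrightarrow> P x y) \<Longrightarrow> sorted_wrt P xs"
proof (induction xs)
  case (Cons a xs)
  have "P a y" if "y \<in> set xs" for y
    using Cons.prems[of a y] that by (simp add: subseq_singleton_left)
  moreover have "P x y" if "subseq [x, y] xs" for x y
    using Cons.prems[of x y] that by (metis list_emb_Cons)
  ultimately show ?case using Cons.IH by simp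
qed simp

text \<open>A descent in \<beta>' would complete a 321 with the larger letter \<open>a\<close> in
  front. It is stated for a subsequence so that it serves both for the small letters of a tail and
  for a whole tail.\<close>

lemma no321_Cons_sorted:
  assumes "no321 (a # \<beta>)" "distinct \<beta>" "subseq \<beta>' \<beta>" "\<forall>x\<in>set \<beta>'. x < a"
  shows "sorted_wrt (<) \<beta>'"
proof -
  have "sorted_wrt (\<le>) \<beta>'"
  proof (rule sorted_wrt_subseqI)
    fix y z assume s: "subseq [y, z] \<beta>'"
    then have "y \<in> set \<beta>'" by (metis in_set_nthsD subseq_conv_nths list.set_intros(1))
    then have "y < a" using assms(4) by blast
    moreover have "subseq [a, y, z] (a # \<beta>)" using s assms(3) subseq_order.trans by fastforce
    ultimately show "y \<le> z" using assms(1) unfolding no321_def by (meson not_le)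
  qed
  moreover have "distinct \<beta>'" using assms(2,3) by (metis distinct_nthsI subseq_conv_nths)
  ultimately show ?thesis by (simp add: strict_sorted_iff)
qed

text \<open>The set counted by \<open>A i m n\<close> in the overview. At \<open>i = l\<close> and
  \<open>m = d\<close> the prefix can serve as \<open>xs\<close> and the letters 1, ...,
  \<open>d\<close> as \<open>ys\<close> and \<open>zs\<close> of a long pattern, so that only the
  large letter \<open>w\<close> is missing.\<close>

definition prefix_avoiders :: "nat \<Rightarrow> nat \<Rightarrow> nat \<Rightarrow> nat \<Rightarrow> nat \<Rightarrow> nat list set" where
  "prefix_avoiders l d i m n = {\<alpha> \<in> avoiders l d n. sorted_wrt (<) (take i \<alpha>) \<and> (\<forall>x\<in>set (take i \<alpha>). m < x) \<and>
     sorted_wrt (<) (filter (\<lambda>x. x \<le> m) \<alpha>)}"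

lemma finite_prefix_avoiders: "finite (prefix_avoiders l d i m n)"
  by (rule finite_subset[of _ "permutations_of_set {1..n}"]) (auto simp: prefix_avoiders_def avoiders_def)

lemma bump_less_iff: "bump v x < bump v y \<longleftrightarrow> x < y"
  by (simp add: strict_mono_less strict_mono_bump)

lemma sorted_map_bump: "sorted_wrt (<) (map (bump v) xs) \<longleftrightarrow> sorted_wrt (<) xs"
  by (simp add: sorted_wrt_map bump_less_iff)

text \<open>The letters below the new first letter \<open>m + 1\<close> are 1, ...,
  \<open>m\<close>, which occur in increasing order, so no 321 arises; and \<open>m + 1\<close> is
  at most \<open>d\<close>, so it cannot start a long pattern. The relabelling fixes the letters up
  to \<open>m\<close> and lifts the others above \<open>m + 1\<close>, so the old prefix extends the
  new one.\<close>

lemma prefix_avoiders_prepend_iff: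
  assumes \<gamma>: "\<gamma> \<in> permutations_of_set {1..n}" and "m < d" "m \<le> n" "1 \<le> l"
  shows "Suc m # map (bump (Suc m)) \<gamma> \<in> prefix_avoiders l d (Suc i) m (Suc n) \<longleftrightarrow> \<gamma> \<in> prefix_avoiders l d i m n"
proof -
  let ?\<beta> = "map (bump (Suc m)) \<gamma>"
  have set: "set \<gamma> = {1..n}" using \<gamma> by (simp add: permutations_of_set_def)
  have perm: "Suc m # ?\<beta> \<in> permutations_of_set {1..Suc n}"
    using perm_insert[OF \<gamma>, of "Suc m" "[]" ?\<beta>] assms(3) by simp
  have filter: "filter (\<lambda>x. x \<le> m) ?\<beta> = filter (\<lambda>x. x \<le> m) \<gamma>"
    by (induction \<gamma>) (auto simp: bump_def)
  have gt: "Suc m < bump (Suc m) x \<longleftrightarrow> m < x" for x by (auto simp: bump_def)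
  have take: "sorted_wrt (<) (take (Suc i) (Suc m # ?\<beta>)) \<longleftrightarrow>
      sorted_wrt (<) (take i \<gamma>) \<and> (\<forall>x\<in>set (take i \<gamma>). m < x)"
    by (auto simp: take_map sorted_map_bump gt)
  have "no321 (Suc m # ?\<beta>) \<longleftrightarrow> no321 \<gamma>" if "sorted_wrt (<) (filter (\<lambda>x. x \<le> m) \<gamma>)"
  proof
    assume "no321 (Suc m # ?\<beta>)"
    then have "no321 ?\<beta>" by (rule no321_subseq) auto
    then show "no321 \<gamma>" by (simp add: no321_map strict_mono_bump)
  next
    assume "no321 \<gamma>"
    then have "no321 ?\<beta>" by (simp add: no321_map strict_mono_bump)
    then show "no321 (Suc m # ?\<beta>)"
      using that by (intro no321_Cons) (simp_all add: less_Suc_eq_le filter)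
  qed
  moreover have "has_X1 l d (Suc m # ?\<beta>) \<longleftrightarrow> has_X1 l d \<gamma>"
  proof
    have "0 \<notin> set ?\<beta>" using set by (auto simp: bump_def split: if_splits)
    moreover assume b: "has_X1 l d (Suc m # ?\<beta>)"
    ultimately have "has_X1 l d ?\<beta>" using has_X1_Cons[OF b] assms by auto
    then show "has_X1 l d \<gamma>" by (simp add: has_X1_map strict_mono_bump)
  next
    assume "has_X1 l d \<gamma>"
    then have "has_X1 l d ?\<beta>" by (simp add: has_X1_map strict_mono_bump)
    then show "has_X1 l d (Suc m # ?\<beta>)" by (rule has_X1_subseq) auto
  qed
  moreover have "\<forall>x\<in>set (take (Suc i) (Suc m # ?\<beta>)). m < x"
    if "\<forall>x\<in>set (take i \<gamma>). m < x"
    using that by (auto simp: take_map bump_def)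
  ultimately show ?thesis
    using perm \<gamma> take filter by (auto simp: prefix_avoiders_def avoiders_def)
qed

text \<open>The two parts are told apart by the first letter, which is at least
  \<open>m + 1\<close>: it can be deleted if it equals \<open>m + 1\<close>, and otherwise avoiding
  321 forces 1, ..., \<open>m + 1\<close> into increasing order.\<close>

lemma prefix_avoiders_prepend_decomp:
  assumes "m < d" "m \<le> n" "1 \<le> l"
  shows "prefix_avoiders l d (Suc i) m (Suc n) = prefix_avoiders l d (Suc i) (Suc m) (Suc n) \<union>
     (\<lambda>\<gamma>. Suc m # map (bump (Suc m)) \<gamma>) ` prefix_avoiders l d i m n"
proof (intro equalityI subsetI)
  fix \<alpha> assume \<alpha>: "\<alpha> \<in> prefix_avoiders l d (Suc i) m (Suc n)"
  then have perm: "\<alpha> \<in> permutations_of_set {1..Suc n}" by (simp add: prefix_avoiders_def avoiders_def)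
  then obtain a \<beta> where a: "\<alpha> = a # \<beta>"
    by (cases \<alpha>) (auto simp: permutations_of_set_def)
  show "\<alpha> \<in> prefix_avoiders l d (Suc i) (Suc m) (Suc n) \<union> (\<lambda>\<gamma>. Suc m # map (bump (Suc m)) \<gamma>) ` prefix_avoiders l d i m n"
  proof (cases "a = Suc m")
    case True
    from perm_delete[of "[]" a \<beta> n] perm a obtain \<gamma>
      where "\<gamma> \<in> permutations_of_set {1..n}" "\<beta> = map (bump a) \<gamma>" by auto
    then show ?thesis using \<alpha> prefix_avoiders_prepend_iff[of \<gamma> n m d l i] assms a True by auto
  next
    case False
    then have gt: "Suc m < a" using \<alpha> a by (auto simp: prefix_avoiders_def)
    \<comment> \<open>All these letters stand behind the larger letter \<open>a\<close>, so a
      descent among them would complete a 321.\<close>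
    have "sorted_wrt (<) (filter (\<lambda>x. x \<le> Suc m) \<beta>)"
    proof (rule no321_Cons_sorted)
      show "no321 (a # \<beta>)" "distinct \<beta>"
        using \<alpha> a perm by (auto simp: prefix_avoiders_def avoiders_def permutations_of_set_def)
    qed (use gt in auto)
    then have "\<alpha> \<in> prefix_avoiders l d (Suc i) (Suc m) (Suc n)"
      using \<alpha> gt a by (auto simp: prefix_avoiders_def intro: less_trans)
    then show ?thesis ..
  qed
next
  fix \<alpha>
  assume "\<alpha> \<in> prefix_avoiders l d (Suc i) (Suc m) (Suc n) \<union> (\<lambda>\<gamma>. Suc m # map (bump (Suc m)) \<gamma>) ` prefix_avoiders l d i m n"
  then show "\<alpha> \<in> prefix_avoiders l d (Suc i) m (Suc n)"
  proof
    assume \<alpha>: "\<alpha> \<in> prefix_avoiders l d (Suc i) (Suc m) (Suc n)"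
    then have "sorted_wrt (<) (filter (\<lambda>x. x \<le> Suc m) \<alpha>)" by (simp add: prefix_avoiders_def)
    then have "sorted_wrt (<) (filter (\<lambda>x. x \<le> m) (filter (\<lambda>x. x \<le> Suc m) \<alpha>))"
      by (rule sorted_wrt_filter)
    moreover have "filter (\<lambda>x. x \<le> m) (filter (\<lambda>x. x \<le> Suc m) \<alpha>) = filter (\<lambda>x. x \<le> m) \<alpha>"
      by (auto intro!: filter_cong)
    ultimately show ?thesis using \<alpha> by (auto simp: prefix_avoiders_def)
  next
    assume "\<alpha> \<in> (\<lambda>\<gamma>. Suc m # map (bump (Suc m)) \<gamma>) ` prefix_avoiders l d i m n"
    then obtain \<gamma> where \<gamma>: "\<alpha> = Suc m # map (bump (Suc m)) \<gamma>" "\<gamma> \<in> prefix_avoiders l d i m n" by blast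
    then have "\<gamma> \<in> permutations_of_set {1..n}" by (simp add: prefix_avoiders_def avoiders_def)
    then show ?thesis using \<gamma> prefix_avoiders_prepend_iff[of \<gamma> n m d l i] assms by simp
  qed
qed

lemma card_prefix_avoiders_prepend:
  assumes "m < d" "m \<le> n" "1 \<le> l"
  shows "card (prefix_avoiders l d (Suc i) m (Suc n)) = card (prefix_avoiders l d (Suc i) (Suc m) (Suc n)) + card (prefix_avoiders l d i m n)"
proof -
  have "inj_on (\<lambda>\<gamma>. Suc m # map (bump (Suc m)) \<gamma>) (prefix_avoiders l d i m n)"
    using inj_mapI[OF strict_mono_imp_inj_on[OF strict_mono_bump]] by (auto simp: inj_on_def)
  moreover have "prefix_avoiders l d (Suc i) (Suc m) (Suc n) \<inter> (\<lambda>\<gamma>. Suc m # map (bump (Suc m)) \<gamma>) ` prefix_avoiders l d i m n = {}"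
    by (auto simp: prefix_avoiders_def)
  ultimately show ?thesis
    unfolding prefix_avoiders_prepend_decomp[OF assms]
    by (simp add: card_Un_disjoint finite_prefix_avoiders card_image)
qed

lemma subseq_insert: "subseq (us @ vs) (us @ a # vs)"
  by (rule list_emb_append_mono) auto

definition insert1 :: "nat \<Rightarrow> nat list \<Rightarrow> nat list" where
  "insert1 i \<gamma> = take i (map (bump 1) \<gamma>) @ 1 # drop i (map (bump 1) \<gamma>)"

text \<open>The new letter 1 stands behind an increasing prefix, so it ends no 321, and it has fewer
  than \<open>l\<close> letters in front of it, so it lies in no long pattern. Hence inserting it is
  harmless in both respects.\<close>

lemma prefix_avoiders_insert1_iff:
  assumes \<gamma>: "\<gamma> \<in> permutations_of_set {1..n}" and "i < l" "i \<le> n" "1 \<le> d"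
  shows "insert1 i \<gamma> \<in> prefix_avoiders l d i (Suc m) (Suc n) \<longleftrightarrow> \<gamma> \<in> prefix_avoiders l d i m n"
proof -
  define us vs where "us = take i (map (bump 1) \<gamma>)" and "vs = drop i (map (bump 1) \<gamma>)"
  have uv: "us @ vs = map (bump 1) \<gamma>" by (simp add: us_def vs_def)
  have ins: "insert1 i \<gamma> = us @ 1 # vs" by (simp add: insert1_def us_def vs_def)
  have set: "set \<gamma> = {1..n}" and len: "length \<gamma> = n"
    using \<gamma> by (auto simp: permutations_of_set_def dest: distinct_card)
  have lu: "length us = i" using len assms(3) by (simp add: us_def)
  have Suc: "bump 1 x = Suc x" if "x \<in> set \<gamma>" for x using that set by (auto simp: bump_def)
  have perm: "us @ 1 # vs \<in> permutations_of_set {1..Suc n}"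
    using perm_insert[OF \<gamma> _ uv] by simp
  have gt1: "\<forall>x\<in>set (us @ vs). 1 < x" unfolding uv using Suc set by auto
  have filter: "filter (\<lambda>x. x \<le> Suc m) (us @ vs) = map (bump 1) (filter (\<lambda>x. x \<le> m) \<gamma>)"
    unfolding uv filter_map o_def using Suc by (auto intro!: arg_cong[where f = "map _"] filter_cong)
  have tk: "sorted_wrt (<) us \<longleftrightarrow> sorted_wrt (<) (take i \<gamma>)"
    by (simp add: us_def take_map sorted_map_bump)
  have tg: "(\<forall>x\<in>set us. Suc m < x) \<longleftrightarrow> (\<forall>x\<in>set (take i \<gamma>). m < x)"
  proof -
    have "\<forall>x\<in>set (take i \<gamma>). bump 1 x = Suc x" using Suc in_set_takeD by fast
    then show ?thesis by (simp add: us_def take_map)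
  qed
  have no: "no321 (us @ 1 # vs) \<longleftrightarrow> no321 \<gamma>" if "sorted_wrt (<) us"
  proof
    assume "no321 (us @ 1 # vs)"
    then have "no321 (us @ vs)" by (rule no321_subseq) (rule subseq_insert)
    then show "no321 \<gamma>" by (simp add: uv no321_map strict_mono_bump)
  next
    assume "no321 \<gamma>"
    then have "no321 (us @ vs)" by (simp add: uv no321_map strict_mono_bump)
    then show "no321 (us @ 1 # vs)" by (rule no321_insert_least[OF _ gt1 that])
  qed
  have bd: "has_X1 l d (us @ 1 # vs) \<longleftrightarrow> has_X1 l d \<gamma>"
  proof
    assume "has_X1 l d (us @ 1 # vs)"
    then have "has_X1 l d (us @ vs)" by (rule has_X1_insert_least[OF _ gt1]) (use lu assms in auto)
    then show "has_X1 l d \<gamma>" by (simp add: uv has_X1_map strict_mono_bump)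
  next
    assume "has_X1 l d \<gamma>"
    then have "has_X1 l d (us @ vs)" by (simp add: uv has_X1_map strict_mono_bump)
    then show "has_X1 l d (us @ 1 # vs)" by (rule has_X1_subseq) (rule subseq_insert)
  qed
  \<comment> \<open>The prefix holds no letter up to \<open>m + 1\<close>, so the 1 is the first of
    these letters and the others are the old letters 1, ..., \<open>m\<close> raised by one.\<close>
  have fl: "sorted_wrt (<) (filter (\<lambda>x. x \<le> Suc m) (us @ 1 # vs)) \<longleftrightarrow>
      sorted_wrt (<) (filter (\<lambda>x. x \<le> m) \<gamma>)" if "\<forall>x\<in>set us. Suc m < x"
  proof -
    have "filter (\<lambda>x. x \<le> Suc m) us = []" using that by (auto simp: filter_empty_conv not_le)
    then have "sorted_wrt (<) (filter (\<lambda>x. x \<le> Suc m) (us @ 1 # vs)) \<longleftrightarrow>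
       sorted_wrt (<) (filter (\<lambda>x. x \<le> Suc m) (us @ vs))"
      using gt1 by auto
    then show ?thesis by (simp add: filter sorted_map_bump del: filter_append)
  qed
  have "take i (us @ 1 # vs) = us" using lu by simp
  then show ?thesis
    unfolding ins prefix_avoiders_def avoiders_def using perm \<gamma> tk tg no bd fl by auto
qed

text \<open>The split is on the letter \<open>a\<close> behind the first \<open>i\<close> letters.
  If it is 1, it can be deleted. Otherwise 1 comes later, and this forces \<open>a\<close> to
  prolong the increasing prefix of large letters.\<close>

lemma prefix_avoiders_insert1_decomp:
  assumes "i < l" "i \<le> n" "1 \<le> d"
  shows "prefix_avoiders l d i (Suc m) (Suc n) = prefix_avoiders l d (Suc i) (Suc m) (Suc n) \<union> insert1 i ` prefix_avoiders l d i m n"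
proof (intro equalityI subsetI)
  fix \<alpha> assume \<alpha>: "\<alpha> \<in> prefix_avoiders l d i (Suc m) (Suc n)"
  then have perm: "\<alpha> \<in> permutations_of_set {1..Suc n}" by (simp add: prefix_avoiders_def avoiders_def)
  then have set: "set \<alpha> = {1..Suc n}" and dist: "distinct \<alpha>" and len: "length \<alpha> = Suc n"
    by (auto simp: permutations_of_set_def dest: distinct_card)
  define us a vs where "us = take i \<alpha>" and "a = \<alpha> ! i" and "vs = drop (Suc i) \<alpha>"
  have eq: "\<alpha> = us @ a # vs"
    unfolding us_def a_def vs_def using len assms(2) by (intro id_take_nth_drop) simp
  have lu: "length us = i" using len assms(2) by (simp add: us_def)
  have gt: "\<forall>x\<in>set us. Suc m < x" using \<alpha> by (simp add: prefix_avoiders_def us_def)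
  show "\<alpha> \<in> prefix_avoiders l d (Suc i) (Suc m) (Suc n) \<union> insert1 i ` prefix_avoiders l d i m n"
  proof (cases "a = 1")
    case True
    from perm_delete[of us a vs n] perm eq obtain \<gamma>
      where \<gamma>: "\<gamma> \<in> permutations_of_set {1..n}" "us @ vs = map (bump 1) \<gamma>"
      using True by metis
    have "insert1 i \<gamma> = \<alpha>" unfolding insert1_def \<gamma>(2)[symmetric] using lu eq True by simp
    then show ?thesis using \<alpha> prefix_avoiders_insert1_iff[of \<gamma> n i l d m] \<gamma>(1) assms by auto
  next
    case False
    have "1 \<in> set \<alpha>" using set by simp
    then have "1 \<in> set vs" using eq gt False by auto
    then have sub: "subseq [a, 1] (a # vs)" by (simp add: subseq_singleton_left)
    have a1: "1 < a" using eq set False by (metis atLeastAtMost_iff in_set_conv_decomp le_neq_implies_less)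
    \<comment> \<open>A prefix letter above \<open>a\<close> would give a 321 with \<open>a\<close>
      and the later 1.\<close>
    have "u < a" if "u \<in> set us" for u
    proof (rule ccontr)
      assume "\<not> u < a"
      moreover have "u \<noteq> a" using dist eq that by auto
      ultimately have "a < u" by simp
      moreover have "subseq ([u] @ [a, 1]) (us @ a # vs)"
        using that sub by (intro list_emb_append_mono) (simp_all add: subseq_singleton_left)
      ultimately show False using \<alpha> a1 eq unfolding prefix_avoiders_def avoiders_def no321_def by auto
    qed
    \<comment> \<open>Otherwise \<open>a\<close> and the later 1 are two of the letters 1, ...,
      \<open>m + 1\<close> in the wrong order.\<close>
    moreover have "Suc m < a"
    proof (rule ccontr)
      assume "\<not> Suc m < a"
      then have "subseq [a, 1] (filter (\<lambda>x. x \<le> Suc m) \<alpha>)"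
        using subseq_filter[OF list_emb_append2[OF sub, of us], of "\<lambda>x. x \<le> Suc m"] eq by auto
      then have "sorted_wrt (<) [a, 1]"
        by (rule sorted_wrt_subseq) (use \<alpha> in \<open>simp add: prefix_avoiders_def\<close>)
      then show False using a1 by simp
    qed
    moreover have "take (Suc i) \<alpha> = us @ [a]" using eq lu by simp
    ultimately have "\<alpha> \<in> prefix_avoiders l d (Suc i) (Suc m) (Suc n)"
      using \<alpha> gt by (auto simp: prefix_avoiders_def us_def sorted_wrt_append)
    then show ?thesis ..
  qed
next
  fix \<alpha>
  assume "\<alpha> \<in> prefix_avoiders l d (Suc i) (Suc m) (Suc n) \<union> insert1 i ` prefix_avoiders l d i m n"
  then show "\<alpha> \<in> prefix_avoiders l d i (Suc m) (Suc n)"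
  proof
    assume \<alpha>: "\<alpha> \<in> prefix_avoiders l d (Suc i) (Suc m) (Suc n)"
    have t: "take i \<alpha> = take i (take (Suc i) \<alpha>)" by simp
    have "sorted_wrt (<) (take i \<alpha>)" "\<forall>x\<in>set (take i \<alpha>). Suc m < x"
      unfolding t using \<alpha> by (auto simp: prefix_avoiders_def simp del: take_take intro: sorted_wrt_take dest: in_set_takeD)
    then show ?thesis using \<alpha> by (auto simp: prefix_avoiders_def)
  next
    assume "\<alpha> \<in> insert1 i ` prefix_avoiders l d i m n"
    then obtain \<gamma> where \<gamma>: "\<alpha> = insert1 i \<gamma>" "\<gamma> \<in> prefix_avoiders l d i m n" by blast
    then have "\<gamma> \<in> permutations_of_set {1..n}" by (simp add: prefix_avoiders_def avoiders_def)
    then show ?thesis using \<gamma> prefix_avoiders_insert1_iff[of \<gamma> n i l d m] assms by simp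
  qed
qed

lemma card_prefix_avoiders_insert1:
  assumes "i < l" "i \<le> n" "1 \<le> d"
  shows "card (prefix_avoiders l d i (Suc m) (Suc n)) = card (prefix_avoiders l d (Suc i) (Suc m) (Suc n)) + card (prefix_avoiders l d i m n)"
proof -
  have len: "length \<gamma> = n" if "\<gamma> \<in> prefix_avoiders l d i m n" for \<gamma>
    using that by (auto simp: prefix_avoiders_def avoiders_def permutations_of_set_def dest: distinct_card)
  have "inj_on (insert1 i) (prefix_avoiders l d i m n)"
  proof (rule inj_onI)
    fix \<gamma> \<gamma>' assume "\<gamma> \<in> prefix_avoiders l d i m n" "\<gamma>' \<in> prefix_avoiders l d i m n" "insert1 i \<gamma> = insert1 i \<gamma>'"
    then have "take i (map (bump 1) \<gamma>) = take i (map (bump 1) \<gamma>')"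
      "drop i (map (bump 1) \<gamma>) = drop i (map (bump 1) \<gamma>')"
      using len by (auto simp: insert1_def)
    then have "map (bump 1) \<gamma> = map (bump 1) \<gamma>'" by (metis append_take_drop_id)
    then show "\<gamma> = \<gamma>'"
      using inj_mapI[OF strict_mono_imp_inj_on[OF strict_mono_bump]] by (metis injD)
  qed
  moreover have "prefix_avoiders l d (Suc i) (Suc m) (Suc n) \<inter> insert1 i ` prefix_avoiders l d i m n = {}"
  proof -
    \<comment> \<open>The inserted 1 is among the first \<open>i + 1\<close> entries, which would
      have to exceed \<open>m + 1\<close>.\<close>
    have "insert1 i \<gamma> \<notin> prefix_avoiders l d (Suc i) (Suc m) (Suc n)" if "\<gamma> \<in> prefix_avoiders l d i m n" for \<gamma>
      using len[OF that] assms(2) by (auto simp: prefix_avoiders_def insert1_def)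
    then show ?thesis by blast
  qed
  ultimately show ?thesis
    unfolding prefix_avoiders_insert1_decomp[OF assms]
    by (simp add: card_Un_disjoint finite_prefix_avoiders card_image)
qed

section \<open>Permutations made of two increasing runs\<close>

text \<open>Of three decreasing entries, two would lie in the same increasing run.\<close>

lemma no321_append_sorted:
  assumes "sorted_wrt (<) us" "sorted_wrt (<) vs"
  shows "no321 (us @ vs)"
  unfolding no321_def
proof (intro allI impI)
  fix x y z assume s: "subseq [x, y, z] (us @ vs)" "z < y" "y < x"
  obtain a b where ab: "[x, y, z] = a @ b" "subseq a us" "subseq b vs"
    using subseq_appendE[OF s(1)] by metis
  have "sorted_wrt (<) a" "sorted_wrt (<) b"
    using ab(2,3) assms sorted_wrt_subseq by blast+
  then show False using ab(1) s(2,3) by (auto simp: Cons_eq_append_conv)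
qed

text \<open>If all of \<open>xs\<close> lies in \<open>us\<close>, the two coincide and
  \<open>w\<close>, taken from \<open>vs\<close>, would have to exceed the last letter of
  \<open>us\<close>. Otherwise some entry of \<open>xs\<close> lies in \<open>vs\<close> and is
  followed there by a smaller entry of \<open>ys\<close> or \<open>zs\<close>.\<close>

lemma not_has_X1_append_sorted:
  assumes "sorted_wrt (<) vs" "length us = l" "us \<noteq> []" "\<forall>x\<in>set vs. x < last us" "1 \<le> d"
  shows "\<not> has_X1 l d (us @ vs)"
proof
  assume "has_X1 l d (us @ vs)"
  then obtain xs ys w zs where s: "subseq (xs @ ys @ w # zs) (us @ vs)" "length xs = l"
     "length ys + length zs = d" "sorted_wrt (<) (ys @ zs @ xs @ [w])"
    unfolding has_X1_def by blast
  obtain a b where ab: "xs @ ys @ w # zs = a @ b" "subseq a us" "subseq b vs"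
    using subseq_appendE[OF s(1)] by metis
  have la: "length a \<le> l" using list_emb_length[OF ab(2)] assms(2) by simp
  define x' where "x' = drop (length a) xs"
  have "a = take (length a) xs"
    using la s(2) arg_cong[OF ab(1), of "take (length a)"] by simp
  moreover have b: "b = x' @ ys @ w # zs"
    using la s(2) arg_cong[OF ab(1), of "drop (length a)"] by (simp add: x'_def)
  have sb: "sorted_wrt (<) b" using ab(3) assms(1) by (rule sorted_wrt_subseq)
  show False
  proof (cases "length a = l")
    case True
    then have "xs = us" using calculation s(2) assms(2) ab(2) subseq_same_length by fastforce
    then have "last us < w" using s(4) assms(3) by (auto simp: sorted_wrt_append)
    moreover have "w \<in> set vs"
      using ab(3) unfolding b by (metis in_set_conv_decomp in_set_nthsD subseq_conv_nths append_assoc)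
    ultimately show False using assms(4) by fastforce
  next
    case False
    then have "x' \<noteq> []" using la s(2) by (simp add: x'_def)
    then obtain x where x: "x \<in> set x'" by fastforce
    then have "x \<in> set xs" unfolding x'_def by (rule in_set_dropD)
    moreover obtain y where y: "y \<in> set (ys @ zs)" using s(3) assms(5) by (cases "ys @ zs") auto
    ultimately have "y < x" using s(4) by (auto simp: sorted_wrt_append)
    moreover have "x < y" using sb x y unfolding b by (auto simp: sorted_wrt_append)
    ultimately show False by simp
  qed
qed

text \<open>The normal form of the words counted by \<open>A l d n\<close>: they are determined by
  the set \<open>S\<close> of the \<open>l - 1\<close> letters in front of \<open>n\<close>.\<close>

definition two_runs :: "nat \<Rightarrow> nat set \<Rightarrow> nat list" where
  "two_runs n S = sorted_list_of_set S @ n # sorted_list_of_set ({1..<n} - S)"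

lemma two_runs_in_prefix_avoiders:
  assumes S: "S \<subseteq> {d<..<n}" "card S = l - 1" and "1 \<le> l" "1 \<le> d" "d < n"
  shows "two_runs n S \<in> prefix_avoiders l d l d n"
proof -
  define us vs where "us = sorted_list_of_set S @ [n]" and "vs = sorted_list_of_set ({1..<n} - S)"
  have fin: "finite S" using S(1) by (rule finite_subset) simp
  have eq: "two_runs n S = us @ vs" by (simp add: two_runs_def us_def vs_def)
  have su: "sorted_wrt (<) us" using S(1) fin by (auto simp: us_def sorted_wrt_append)
  have sv: "sorted_wrt (<) vs" by (simp add: vs_def)
  have setu: "set us = insert n S" using fin by (simp add: us_def)
  have setv: "set vs = {1..<n} - S" by (simp add: vs_def)
  have lu: "length us = l" using S(2) assms(3) by (simp add: us_def)
  have "set (us @ vs) = {1..n}" using setu setv S(1) assms(5) by auto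
  moreover have "distinct (us @ vs)"
    using su sv setu setv S(1) by (auto simp: strict_sorted_iff)
  ultimately have "us @ vs \<in> permutations_of_set {1..n}" by (simp add: permutations_of_set_def)
  moreover have "\<not> has_X1 l d (us @ vs)"
  proof (rule not_has_X1_append_sorted[OF sv lu])
    show "us \<noteq> []" by (simp add: us_def)
    show "\<forall>x\<in>set vs. x < last us" using setv by (simp add: us_def)
  qed (rule assms)
  moreover have "filter (\<lambda>x. x \<le> d) us = []"
    using setu S(1) assms(5) by (auto simp: filter_empty_conv not_le)
  then have "sorted_wrt (<) (filter (\<lambda>x. x \<le> d) (us @ vs))"
    using sv by (simp add: sorted_wrt_filter)
  moreover have "\<forall>x\<in>set us. d < x" using setu S(1) assms(5) by auto
  ultimately show ?thesis
    unfolding eq prefix_avoiders_def avoiders_def using su sv lu by (auto intro: no321_append_sorted)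
qed

text \<open>If the \<open>l\<close>-th entry were not \<open>n\<close>, then \<open>n\<close> would
  come later, and the first \<open>l\<close> entries, the letters 1, ..., \<open>d\<close> and
  \<open>n\<close> would form a long pattern. Behind \<open>n\<close>, avoiding 321 forces
  increasing order.\<close>

lemma prefix_avoiders_two_runsE:
  assumes \<alpha>: "\<alpha> \<in> prefix_avoiders l d l d n" and "1 \<le> l" "1 \<le> d" "l + d \<le> n"
  obtains S where "S \<subseteq> {d<..<n}" "card S = l - 1" "\<alpha> = two_runs n S"
proof -
  have set: "set \<alpha> = {1..n}" and dist: "distinct \<alpha>" and len: "length \<alpha> = n"
    using \<alpha> by (auto simp: prefix_avoiders_def avoiders_def permutations_of_set_def dest: distinct_card)
  define us a vs where "us = take (l - 1) \<alpha>" and "a = \<alpha> ! (l - 1)" and "vs = drop l \<alpha>"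
  have lt: "l - 1 < length \<alpha>" using len assms by simp
  have eq: "\<alpha> = us @ a # vs"
    using id_take_nth_drop[OF lt] assms(2) by (simp add: us_def a_def vs_def)
  have tk: "take l \<alpha> = us @ [a]"
    using take_Suc_conv_app_nth[OF lt] assms(2) by (simp add: us_def a_def)
  have su: "sorted_wrt (<) (us @ [a])" and gt: "\<forall>x\<in>set (us @ [a]). d < x"
    and sf: "sorted_wrt (<) (filter (\<lambda>x. x \<le> d) \<alpha>)"
    using \<alpha> by (simp_all add: prefix_avoiders_def flip: tk)
  have lu: "length us = l - 1" using lt by (simp add: us_def)
  have "a \<in> set \<alpha>" by (simp add: eq)
  then have "a \<le> n" using set by simp
  moreover have "\<forall>x\<in>set us. x < a" using su by (simp add: sorted_wrt_append)
  ultimately have an: "a \<le> n" "\<forall>x\<in>set us. x < n" by auto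
  have a: "a = n"
  proof (rule ccontr)
    assume "a \<noteq> n"
    moreover have "n \<in> set \<alpha>" using set assms by simp
    ultimately have "n \<in> set vs" using an unfolding eq by auto
    then obtain u v where uv: "vs = u @ n # v" by (auto simp: in_set_conv_decomp)
    \<comment> \<open>The letters 1, ..., \<open>d\<close> are divided by the position of
      \<open>n\<close>. This position is arbitrary, so the patterns for all values of the index
      \<open>j\<close>, here the length of \<open>ys\<close>, come into play.\<close>
    define ys zs where "ys = filter (\<lambda>x. x \<le> d) u" and "zs = filter (\<lambda>x. x \<le> d) v"
    have "filter (\<lambda>x. x \<le> d) (us @ [a]) = []"
      using gt by (auto simp: filter_empty_conv not_le)
    then have f: "filter (\<lambda>x. x \<le> d) \<alpha> = ys @ zs"
      using assms by (simp add: eq uv ys_def zs_def split: if_splits)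
    have "set (ys @ zs) = {1..d}" unfolding f[symmetric] using set assms(4) by auto
    moreover have "distinct (ys @ zs)" unfolding f[symmetric] using dist by simp
    ultimately have "length (ys @ zs) = d"
      by (metis card_atLeastAtMost diff_Suc_1 distinct_card)
    moreover have "sorted_wrt (<) ((ys @ zs) @ (us @ [a]) @ [n])"
    proof -
      have "\<forall>x\<in>set (us @ [a]). x < n" using an \<open>a \<noteq> n\<close> by auto
      then have "sorted_wrt (<) ((us @ [a]) @ [n])"
        using su by (subst sorted_wrt_append) simp
      moreover have "x < y" if "x \<in> set (ys @ zs)" "y \<in> set ((us @ [a]) @ [n])" for x y
      proof -
        have "x \<le> d" using that(1) by (auto simp: ys_def zs_def)
        moreover have "d < y" using that(2) gt assms(2,4) by auto
        ultimately show ?thesis by simp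
      qed
      ultimately show ?thesis using sf[unfolded f] by (subst sorted_wrt_append) blast
    qed
    moreover have "subseq (ys @ n # zs) (u @ n # v)"
      unfolding ys_def zs_def by (rule list_emb_append_mono) auto
    then have "subseq ((us @ [a]) @ ys @ n # zs) \<alpha>"
      using list_emb_append_mono[OF subseq_order.refl, of "ys @ n # zs" "u @ n # v" "us @ [a]"]
      by (simp add: eq uv)
    moreover have "length (us @ [a]) = l" using lu assms(2) by simp
    ultimately have "has_X1 l d \<alpha>"
      unfolding has_X1_def by (intro exI[of _ "us @ [a]"] exI[of _ ys] exI[of _ n] exI[of _ zs]) simp
    then show False using \<alpha> by (simp add: prefix_avoiders_def avoiders_def)
  qed
  have sv: "sorted_wrt (<) vs"
  proof (rule no321_Cons_sorted)
    have "no321 \<alpha>" using \<alpha> by (simp add: prefix_avoiders_def avoiders_def)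
    then show "no321 (n # vs)" by (rule no321_subseq) (simp add: eq a list_emb_append2)
    show "distinct vs" using dist by (simp add: vs_def)
    show "\<forall>x\<in>set vs. x < n"
    proof
      fix x assume "x \<in> set vs"
      then have "x \<le> n" "x \<noteq> n" using set dist unfolding eq a by auto
      then show "x < n" by simp
    qed
  qed simp
  have us: "sorted_list_of_set (set us) = us" and vs: "sorted_list_of_set (set vs) = vs"
    using su sv by (auto simp: sorted_wrt_append strict_sorted_iff sorted_list_of_set.idem_if_sorted_distinct)
  have svs: "set vs = {1..<n} - set us"
  proof -
    have "set vs = {1..n} - insert n (set us)" using set dist unfolding eq a by auto
    also have "\<dots> = {1..<n} - set us" by auto
    finally show ?thesis .
  qed
  have "\<alpha> = two_runs n (set us)"
    unfolding two_runs_def us svs[symmetric] vs eq a ..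
  moreover have "card (set us) = l - 1" using dist lu unfolding eq by (simp add: distinct_card)
  moreover have "set us \<subseteq> {d<..<n}" using gt an(2) by auto
  ultimately show ?thesis using that by blast
qed

lemma card_prefix_avoiders_final:
  assumes "1 \<le> l" "1 \<le> d" "l + d \<le> n"
  shows "card (prefix_avoiders l d l d n) = (n - d - 1) choose (l - 1)"
proof -
  let ?F = "{S. S \<subseteq> {d<..<n} \<and> card S = l - 1}"
  have "prefix_avoiders l d l d n = two_runs n ` ?F"
  proof (intro equalityI subsetI)
    fix \<alpha> assume "\<alpha> \<in> prefix_avoiders l d l d n"
    then obtain S where "S \<subseteq> {d<..<n}" "card S = l - 1" "\<alpha> = two_runs n S"
      using prefix_avoiders_two_runsE assms by blast
    then show "\<alpha> \<in> two_runs n ` ?F" by blast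
  next
    fix \<alpha> assume "\<alpha> \<in> two_runs n ` ?F"
    then show "\<alpha> \<in> prefix_avoiders l d l d n" using two_runs_in_prefix_avoiders[of _ d n l] assms by auto
  qed
  moreover have "inj_on (two_runs n) ?F"
  proof (rule inj_onI)
    fix S T assume ST: "S \<in> ?F" "T \<in> ?F" "two_runs n S = two_runs n T"
    then have fin: "finite S" "finite T" by (auto intro: finite_subset[of _ "{d<..<n}"])
    \<comment> \<open>Both first runs have \<open>l - 1\<close> letters, so the two equal words are
      cut at the same place.\<close>
    have "sorted_list_of_set S = sorted_list_of_set T"
      using ST fin by (simp add: two_runs_def append_eq_append_conv)
    then show "S = T" using fin by (metis set_sorted_list_of_set)
  qed
  ultimately have "card (prefix_avoiders l d l d n) = card ?F" by (simp add: card_image)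
  also have "\<dots> = card {d<..<n} choose (l - 1)" by (rule n_subsets) simp
  finally show ?thesis by simp
qed

section \<open>Fibonacci polynomials and Catalan numbers\<close>

text \<open>The polynomials \<open>x\<^bsup>m/2\<^esup> U\<^bsub>m\<^esub>(1 / (2\<surd>x))\<close>.\<close>
fun fib_fps :: "nat \<Rightarrow> real fps" where
  "fib_fps 0 = 1"
| "fib_fps (Suc 0) = 1"
| "fib_fps (Suc (Suc m)) = fib_fps (Suc m) - fps_X * fib_fps m"

text \<open>Pascal's rule. For \<open>j > m\<close> truncated subtraction turns every upper index
  into 0 while the lower ones are positive, so all terms vanish.\<close>

lemma choose_diff_rec:
  "(Suc (Suc m) - Suc j choose Suc j) = (Suc m - Suc j choose Suc j) + (m - j choose j)"
proof (cases "j \<le> m")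
  case True
  then show ?thesis by (simp add: Suc_diff_le)
qed simp

lemma fib_fps_nth: "fib_fps m $ j = (-1) ^ j * real (m - j choose j)"
proof (induction m arbitrary: j rule: fib_fps.induct)
  case (3 m)
  show ?case
  proof (cases j)
    case (Suc i)
    show ?thesis
      unfolding Suc choose_diff_rec using 3 by (simp add: algebra_simps)
  qed (use 3 in simp)
qed (auto simp: fps_one_nth split: nat.splits; case_tac j; simp)+

lemma fib_fps_mult_nth:
  assumes "m \<le> n"
  shows "(fib_fps m * A) $ n = (\<Sum>j = 0..m. (-1) ^ j * real (m - j choose j) * A $ (n - j))"
proof -
  have "(fib_fps m * A) $ n = (\<Sum>j = 0..n. fib_fps m $ j * A $ (n - j))"
    by (rule fps_mult_nth)
  also have "\<dots> = (\<Sum>j = 0..m. fib_fps m $ j * A $ (n - j))"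
    \<comment> \<open>For \<open>j > m\<close> the coefficient contains \<open>0 choose j\<close>
      with positive \<open>j\<close>, which is 0.\<close>
    using assms by (intro sum.mono_neutral_right) (auto simp: fib_fps_nth)
  finally show ?thesis by (simp add: fib_fps_nth)
qed

lemma fib_fps_mult_rec:
  "(fib_fps (Suc (Suc m)) * A) $ Suc n = (fib_fps (Suc m) * A) $ Suc n - (fib_fps m * A) $ n"
  by (simp add: left_diff_distrib mult.assoc)

section \<open>Catalan and ballot numbers\<close>

definition catalan :: "nat \<Rightarrow> real" where
  "catalan n = 1 / (real n + 1) * real ((2 * n) choose n)"

text \<open>The right-hand side is a ballot number. The induction follows the recurrence of
  \<open>fib_fps\<close>, and the value 1 at \<open>m = n\<close> is what later identifies the
  number of 321-avoiders.\<close>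

lemma fib_fps_mult_catalan:
  assumes "m \<le> n"
  shows "(fib_fps m * Abs_fps catalan) $ n = (real m + 1) / (real n + 1) * real (2 * n - m choose n)"
  using assms
proof (induction m arbitrary: n rule: fib_fps.induct)
  case 1
  then show ?case by (simp add: catalan_def)
next
  case 2
  then obtain p where p: "n = Suc p" by (cases n) auto
  have "2 * real (Suc (2 * p) choose Suc p) = real (2 * Suc p choose Suc p)"
  proof -
    have "(Suc (2 * p) choose p) = (Suc (2 * p) choose Suc p)"
      using binomial_symmetric[of p "Suc (2 * p)"] by simp
    then show ?thesis by simp
  qed
  then show ?case by (simp add: catalan_def p del: binomial_Suc_Suc)
next
  case (3 m)
  then obtain p where p: "n = Suc p" by (cases n) auto
  have mp: "Suc m \<le> p" using 3 p by simp
  \<comment> \<open>The upper indices for \<open>m\<close>, \<open>m + 1\<close> and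
    \<open>m + 2\<close> become \<open>N\<close>, \<open>N + 1\<close> and \<open>N\<close>, so the
    three binomial coefficients are \<open>b\<close>, \<open>b + c\<close> and \<open>c\<close>.
    Absorption then gives the ratio of \<open>c\<close> to \<open>b\<close>.\<close>
  define N where "N = 2 * p - m"
  have eqs: "2 * Suc p - Suc (Suc m) = N" "2 * Suc p - Suc m = Suc N" "2 * p - m = N"
    using mp by (auto simp: N_def)
  define b c where "b = real (N choose p)" and "c = real (N choose Suc p)"
  have "Suc p * (N choose Suc p) = (N - p) * (N choose p)"
    using binomial_absorb_comp[of N p] binomial_absorption[of p N] by (simp add: mult.commute)
  moreover have "N - p = p - m" by (simp add: N_def)
  ultimately have "real (Suc p) * c = real (p - m) * b"
    unfolding b_def c_def by (metis of_nat_mult)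
  then have bc: "c = (real p - real m) / (real p + 1) * b"
    using mp by (simp add: field_simps of_nat_diff)
  have "(fib_fps (Suc (Suc m)) * Abs_fps catalan) $ n =
      (real m + 2) / (real p + 2) * (b + c) - (real m + 1) / (real p + 1) * b"
  proof -
    have "(fib_fps (Suc m) * Abs_fps catalan) $ Suc p = (real m + 2) / (real p + 2) * (b + c)"
      using 3(1)[of "Suc p"] mp unfolding eqs by (simp add: b_def c_def add_ac)
    moreover have "(fib_fps m * Abs_fps catalan) $ p = (real m + 1) / (real p + 1) * b"
      using 3(2)[of p] mp unfolding eqs by (simp add: b_def)
    ultimately show ?thesis unfolding p fib_fps_mult_rec by simp
  qed
  also have "\<dots> = (real m + 3) / (real p + 2) * c"
    unfolding bc by (simp add: divide_simps) (simp add: algebra_simps)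
  finally show ?case by (simp add: p eqs c_def add_ac)
qed

lemma fib_fps_mult_catalan_diag: "(fib_fps n * Abs_fps catalan) $ n = 1"
  by (simp add: fib_fps_mult_catalan)

text \<open>The quotient of \<open>fib_fps (m - 1)\<close> by \<open>fib_fps m\<close> is a
  convergent of the continued fraction of the Catalan series, and agrees with it below degree
  \<open>m\<close>.\<close>

lemma fib_fps_mult_catalan_below:
  "n < m \<Longrightarrow> (fib_fps m * Abs_fps catalan) $ n = fib_fps (m - 1) $ n"
proof (induction m arbitrary: n rule: fib_fps.induct)
  case 2
  then show ?case by (simp add: catalan_def)
next
  case (3 m)
  show ?case
  proof (cases n)
    case 0
    have "fib_fps k $ 0 = 1" for k by (simp add: fib_fps_nth)
    then show ?thesis using 0 by (simp add: fps_mult_nth catalan_def)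
  next
    case (Suc p)
    show ?thesis
    \<comment> \<open>At the top index the induction hypothesis does not apply, but there both terms
      of the recurrence are the diagonal value 1 and cancel.\<close>
    proof (cases "p = m")
      case True
      then have "(fib_fps (Suc (Suc m)) * Abs_fps catalan) $ n = 0"
        unfolding Suc fib_fps_mult_rec by (simp only: fib_fps_mult_catalan_diag)
      then show ?thesis using Suc True by (simp add: fib_fps_nth)
    next
      case False
      then have "p < m" using 3(3) Suc by simp
      then obtain q where q: "m = Suc q" by (cases m) auto
      have "(fib_fps (Suc (Suc m)) * Abs_fps catalan) $ n = fib_fps m $ Suc p - fib_fps (m - 1) $ p"
        unfolding Suc fib_fps_mult_rec using 3(1)[of "Suc p"] 3(2)[of p] \<open>p < m\<close> by simp
      then show ?thesis by (simp add: q Suc)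
    qed
  qed
qed simp

section \<open>Chebyshev polynomials at $1/(2s)$\<close>

definition binomial_fps :: "nat \<Rightarrow> real fps" where
  "binomial_fps p = Abs_fps (\<lambda>n. real (n + p choose p))"

text \<open>By Pascal's rule a factor \<open>1 - fps_X\<close> lowers the parameter by one.\<close>

lemma binomial_fps_mult: "binomial_fps p * (1 - fps_X) ^ Suc p = 1"
proof (induction p)
  case 0
  have "binomial_fps 0 * (1 - fps_X) = 1"
    by (rule fps_ext) (auto simp: binomial_fps_def right_diff_distrib)
  then show ?case by simp
next
  case (Suc p)
  have "binomial_fps (Suc p) * (1 - fps_X) = binomial_fps p"
  proof (rule fps_ext)
    fix n
    show "(binomial_fps (Suc p) * (1 - fps_X)) $ n = binomial_fps p $ n"
      by (cases n) (simp_all add: binomial_fps_def right_diff_distrib)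
  qed
  then have "binomial_fps (Suc p) * (1 - fps_X) ^ Suc (Suc p) = binomial_fps p * (1 - fps_X) ^ Suc p"
    by (metis mult.assoc power_Suc)
  with Suc show ?case by simp
qed

section \<open>The Chebyshev recurrence over Laurent series\<close>

lemma chebyshev_U_0: "chebyshev_U 0 = 1"
  by (rule poly_eq_on_cos) (simp add: poly_chebyshev_U_cos)

lemma chebyshev_U_1: "chebyshev_U (Suc 0) = [:0, 2:]"
  by (rule poly_eq_on_cos) (simp add: poly_chebyshev_U_cos sin_double)

text \<open>This is sin(a + t) + sin(a - t) = 2 cos t sin a with a = (m + 2) t, read as an identity
  of polynomials in cos t.\<close>

lemma chebyshev_U_rec: "chebyshev_U (Suc (Suc m)) = [:0, 2:] * chebyshev_U (Suc m) - chebyshev_U m"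
proof (rule poly_eq_on_cos)
  fix \<theta> :: real assume s: "sin \<theta> \<noteq> 0"
  define a where "a = real (Suc m + 1) * \<theta>"
  have *: "real (m + 1) * \<theta> = a - \<theta>" "real (Suc (Suc m) + 1) * \<theta> = a + \<theta>"
    by (simp_all add: a_def algebra_simps)
  have "poly ([:0, 2:] * chebyshev_U (Suc m) - chebyshev_U m) (cos \<theta>) =
      (2 * cos \<theta> * sin a - sin (a - \<theta>)) / sin \<theta>"
    by (simp only: poly_diff poly_mult poly_chebyshev_U_cos[OF s] * flip: a_def)
      (simp add: diff_divide_distrib)
  also have "2 * cos \<theta> * sin a - sin (a - \<theta>) = sin (a + \<theta>)"
    by (simp add: sin_add sin_diff)
  finally show "poly (chebyshev_U (Suc (Suc m))) (cos \<theta>) =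
      poly ([:0, 2:] * chebyshev_U (Suc m) - chebyshev_U m) (cos \<theta>)"
    by (simp only: poly_chebyshev_U_cos[OF s] *)
qed

lemma chebyshev_U_fls_0: "chebyshev_U_fls 0 f = 1"
  by (simp add: chebyshev_U_fls_def chebyshev_U_0 map_poly_1)

lemma chebyshev_U_fls_1: "chebyshev_U_fls (Suc 0) f = 2 * f"
  by (simp add: chebyshev_U_fls_def chebyshev_U_1 map_poly_pCons mult.commute)

lemma chebyshev_U_fls_rec:
  "chebyshev_U_fls (Suc (Suc m)) f = 2 * f * chebyshev_U_fls (Suc m) f - chebyshev_U_fls m f"
proof -
  have diff: "map_poly fls_const (p - q) = map_poly fls_const p - map_poly fls_const q" for p q :: "real poly"
    by (rule poly_eqI) (simp add: coeff_map_poly fls_minus_const)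
  have "map_poly fls_const ([:0, 2:] * p) = pCons 0 (smult 2 (map_poly fls_const p))" for p :: "real poly"
    by (rule poly_eqI) (simp add: coeff_map_poly coeff_pCons fls_const_mult_const[symmetric] split: nat.splits)
  then show ?thesis
    by (simp only: chebyshev_U_fls_def chebyshev_U_rec diff) (simp add: algebra_simps)
qed

text \<open>The substitution x = s^2, where s is \<open>fls_X\<close> and stands for the square root
  of x. It respects sums, differences and products, so identities between power series carry
  over.\<close>

definition sq_fls :: "real fps \<Rightarrow> real fls" where
  "sq_fls F = fps_to_fls (fps_compose F (fps_X ^ 2))"

lemma sq_fls_simps:
  "sq_fls (F + G) = sq_fls F + sq_fls G" "sq_fls (F - G) = sq_fls F - sq_fls G"
  "sq_fls (F * G) = sq_fls F * sq_fls G" "sq_fls 1 = 1"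
  "sq_fls fps_X = fls_X ^ 2"
  by (simp_all add: sq_fls_def fps_compose_add_distrib fps_compose_sub_distrib fps_compose_mult_distrib
      fls_times_fps_to_fls fps_to_fls_power)

lemma sq_fls_power: "sq_fls (F ^ n) = sq_fls F ^ n"
  by (induction n) (simp_all add: sq_fls_simps)

lemma sq_fls_nonzero: "F $ 0 \<noteq> 0 \<Longrightarrow> sq_fls F \<noteq> 0"
proof
  assume "F $ 0 \<noteq> 0" "sq_fls F = 0"
  then have "fps_compose F (fps_X ^ 2) = 0" by (simp add: sq_fls_def)
  then have "fps_compose F (fps_X ^ 2) $ 0 = 0" by simp
  then show False using \<open>F $ 0 \<noteq> 0\<close> by simp
qed

text \<open>Multiplying the Chebyshev recurrence at 1 / (2s) by the power s^(m+2) absorbs the factor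
  2 / (2s) and leaves s^2 in front of the last term, which is the recurrence of
  \<open>fib_fps\<close> at x = s^2.\<close>

lemma chebyshev_U_fls_fib: "fls_X ^ m * chebyshev_U_fls m (1 / (2 * fls_X)) = sq_fls (fib_fps m)"
proof -
  define f where "f = (1 / (2 * fls_X) :: real fls)"
  have cancel: "s * (2 * (1 / (2 * s))) = 1" if "s \<noteq> 0" for s :: "real fls"
    using that by (simp add: field_simps)
  have f: "fls_X * (2 * f) = 1" unfolding f_def by (rule cancel) simp
  show ?thesis
    unfolding f_def[symmetric]
  proof (induction m rule: fib_fps.induct)
    case 1
    then show ?case by (simp add: chebyshev_U_fls_0 sq_fls_simps)
  next
    case 2
    then show ?case using f by (simp add: chebyshev_U_fls_1 sq_fls_simps)
  next
    case (3 m)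
    have "fls_X ^ Suc (Suc m) * chebyshev_U_fls (Suc (Suc m)) f =
        (fls_X * (2 * f)) * (fls_X ^ Suc m * chebyshev_U_fls (Suc m) f) -
        fls_X ^ 2 * (fls_X ^ m * chebyshev_U_fls m f)"
      by (simp add: chebyshev_U_fls_rec algebra_simps power2_eq_square)
    then show ?case unfolding 3 f by (simp add: sq_fls_simps)
  qed
qed

lemma gf_fls:
  assumes "(fib_fps (Suc r) * A - fib_fps r) * (1 - fps_X) ^ q = fps_X ^ Suc r"
  shows "sq_fls A = (chebyshev_U_fls r (1 / (2 * fls_X)) + fls_X ^ (r + 2) / (1 - fls_X ^ 2) ^ q)
     / (fls_X * chebyshev_U_fls (Suc r) (1 / (2 * fls_X)))"
proof -
  define s where "s = (fls_X :: real fls)"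
  have s0: "s \<noteq> 0" by (simp add: s_def)
  define u where "u = (1 - s ^ 2) ^ q"
  define G where "G = sq_fls (fib_fps (Suc r))"
  have "sq_fls (1 - fps_X) \<noteq> 0" by (rule sq_fls_nonzero) simp
  then have u0: "u \<noteq> 0" by (simp add: u_def s_def sq_fls_simps)
  have G0: "G \<noteq> 0" unfolding G_def by (rule sq_fls_nonzero) (simp add: fib_fps_nth)
  have eq: "(G * sq_fls A - sq_fls (fib_fps r)) * u = (s ^ 2) ^ Suc r"
    using arg_cong[OF assms, of sq_fls] by (simp only: sq_fls_simps sq_fls_power u_def s_def G_def)
  have U: "chebyshev_U_fls r (1 / (2 * s)) = sq_fls (fib_fps r) / s ^ r"
    "chebyshev_U_fls (Suc r) (1 / (2 * s)) = G / s ^ Suc r"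
    using chebyshev_U_fls_fib[of r] chebyshev_U_fls_fib[of "Suc r"] s0
    by (simp_all only: G_def flip: s_def) (simp_all add: field_simps)
  have "sq_fls (fib_fps r) + s ^ (2 * r + 2) / u = G * sq_fls A"
  proof -
    have "(s ^ 2) ^ Suc r = s ^ (2 * r + 2)" by (simp add: power_mult power2_eq_square)
    then show ?thesis using eq u0 by (simp add: field_simps del: power_Suc)
  qed
  \<comment> \<open>Numerator and denominator are both multiplied by s^r, which clears the powers of
    s coming from the two Chebyshev values.\<close>
  moreover have "(sq_fls (fib_fps r) / s ^ r + s ^ (r + 2) / u) / (s * (G / s ^ Suc r)) =
      (sq_fls (fib_fps r) + s ^ (2 * r + 2) / u) / G"
    using s0 u0 G0 by (simp add: field_simps power_add mult_2 mult_2_right)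
  ultimately have "(sq_fls (fib_fps r) / s ^ r + s ^ (r + 2) / u) / (s * (G / s ^ Suc r)) = sq_fls A"
    using G0 by simp
  then show ?thesis
    by (simp only: U u_def flip: s_def)
qed

section \<open>Enumeration\<close>

text \<open>Both recurrences give the same sum,
  \<open>A (i+1) (m+1) (n+1) + A i m n\<close>.\<close>

lemma card_prefix_avoiders_shift:
  assumes "i < l" "m < d" "i \<le> n" "m \<le> n"
  shows "card (prefix_avoiders l d (Suc i) m (Suc n)) = card (prefix_avoiders l d i (Suc m) (Suc n))"
  using card_prefix_avoiders_prepend[of m d n l i] card_prefix_avoiders_insert1[of i l n d m] assms by simp

lemma prefix_avoiders_1_0: "prefix_avoiders l d (Suc 0) 0 n = avoiders l d n"
proof -
  have "sorted_wrt (<) (take (Suc 0) \<alpha>) \<and> (\<forall>x\<in>set (take (Suc 0) \<alpha>). 0 < x) \<and>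
      sorted_wrt (<) (filter (\<lambda>x. x \<le> 0) \<alpha>)" if "\<alpha> \<in> avoiders l d n" for \<alpha>
  proof -
    have "0 \<notin> set \<alpha>" using that by (auto simp: avoiders_def permutations_of_set_def)
    then have "filter (\<lambda>x. x \<le> 0) \<alpha> = []" by (auto simp: filter_empty_conv intro: ccontr)
    then show ?thesis using \<open>0 \<notin> set \<alpha>\<close> by (cases \<alpha>) auto
  qed
  then show ?thesis by (auto simp: prefix_avoiders_def)
qed

lemma prefix_avoiders_0_0: "prefix_avoiders l d 0 0 n = avoiders l d n"
  using prefix_avoiders_1_0[of l d n] by (auto simp: prefix_avoiders_def)

lemma card_prefix_avoiders:
  assumes "1 \<le> l" "1 \<le> d" "i \<le> l" "m \<le> d" "i + m \<le> n"
  shows "real (card (prefix_avoiders l d i m n)) = (fib_fps (i + m) * Abs_fps (\<lambda>n. real (card (avoiders l d n)))) $ n"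
  using assms(3-5)
proof (induction "i + m" arbitrary: i m n rule: less_induct)
  case less
  let ?A = "Abs_fps (\<lambda>n. real (card (avoiders l d n)))"
  \<comment> \<open>The case where both parameters are positive takes the induction hypothesis as a
    premise, because the boundary cases with one parameter zero and the other at least 2 are shifted
    to it without lowering \<open>i + m\<close>.\<close>
  have step: "real (card (prefix_avoiders l d (Suc i) (Suc m) n)) = (fib_fps (Suc i + Suc m) * ?A) $ n"
    if *: "Suc i \<le> l" "Suc m \<le> d" "Suc i + Suc m \<le> n"
      and IH: "\<And>i' m' n'. i' + m' < Suc i + Suc m \<Longrightarrow> i' \<le> l \<Longrightarrow> m' \<le> d \<Longrightarrow> i' + m' \<le> n' \<Longrightarrow>
        real (card (prefix_avoiders l d i' m' n')) = (fib_fps (i' + m') * ?A) $ n'" for i m n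
  proof -
    obtain p where p: "n = Suc p" using *(3) by (cases n) auto
    have "card (prefix_avoiders l d i (Suc m) n) = card (prefix_avoiders l d (Suc i) (Suc m) n) + card (prefix_avoiders l d i m p)"
      unfolding p using * p assms(2) by (intro card_prefix_avoiders_insert1) auto
    then have "real (card (prefix_avoiders l d (Suc i) (Suc m) n)) =
        real (card (prefix_avoiders l d i (Suc m) n)) - real (card (prefix_avoiders l d i m p))" by simp
    also have "\<dots> = (fib_fps (Suc (i + m)) * ?A) $ Suc p - (fib_fps (i + m) * ?A) $ p"
      using IH[of i "Suc m" n] IH[of i m p] * p by simp
    also have "\<dots> = (fib_fps (Suc i + Suc m) * ?A) $ n"
      unfolding p fib_fps_mult_rec[symmetric] by simp
    finally show ?thesis .
  qed
  consider "i = 0" "m = 0" | "i = 1" "m = 0" | "i = 0" "m = 1"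
    | i' m' where "i = Suc i'" "m = Suc m'" | i' where "i = Suc (Suc i')" "m = 0"
    | m' where "i = 0" "m = Suc (Suc m')"
    by (cases i; cases "i - 1"; cases m; cases "m - 1") auto
  then show ?case
  proof cases
    case 1
    then show ?thesis by (simp add: prefix_avoiders_0_0)
  next
    case 2
    then show ?thesis by (simp add: prefix_avoiders_1_0)
  next
    case 3
    then obtain p where "n = Suc p" using less by (cases n) auto
    then have "card (prefix_avoiders l d 0 1 n) = card (avoiders l d n)"
      using card_prefix_avoiders_shift[of 0 l 0 d p] assms by (simp add: prefix_avoiders_1_0)
    then show ?thesis using 3 by simp
  next
    case 4
    then show ?thesis using step[of i' m' n] less by simp
  next
    case 5
    obtain p where p: "n = Suc p" using less 5 by (cases n) auto
    have "card (prefix_avoiders l d i m n) = card (prefix_avoiders l d (Suc i') (Suc 0) n)"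
      unfolding p 5 using less 5 p assms by (intro card_prefix_avoiders_shift) auto
    then show ?thesis using step[of i' 0 n] less 5 assms by simp
  next
    case 6
    obtain p where p: "n = Suc p" using less 6 by (cases n) auto
    have "card (prefix_avoiders l d i m n) = card (prefix_avoiders l d (Suc 0) (Suc m') n)"
      unfolding p 6 using less 6 p assms by (intro card_prefix_avoiders_shift[symmetric]) auto
    then show ?thesis using step[of 0 m' n] less 6 assms by simp
  qed
qed

text \<open>Two evaluations of \<open>A l d n\<close> are compared. The lower bound includes
  \<open>n = l + d\<close>, where no long pattern fits yet; this case is what yields the Catalan
  numbers.\<close>

lemma avoiders_recurrence:
  assumes "1 \<le> l" "1 \<le> d" "l + d \<le> n"
  shows "(fib_fps (l + d) * Abs_fps (\<lambda>n. real (card (avoiders l d n)))) $ n = real (n - d - 1 choose (l - 1))"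
  using card_prefix_avoiders[of l d l d n] card_prefix_avoiders_final[of l d n] assms by simp

section \<open>Short permutations and the generating function\<close>

lemma avoiders_short:
  assumes "n \<le> l + d"
  shows "avoiders l d n = {\<alpha> \<in> permutations_of_set {1..n}. no321 \<alpha>}"
proof -
  have "\<not> has_X1 l d \<alpha>" if "\<alpha> \<in> permutations_of_set {1..n}" for \<alpha>
  proof
    have len: "length \<alpha> = n" using that by (auto simp: permutations_of_set_def dest: distinct_card)
    assume "has_X1 l d \<alpha>"
    then obtain xs ys w zs where "subseq (xs @ ys @ w # zs) \<alpha>" "length xs = l" "length ys + length zs = d"
      unfolding has_X1_def by blast
    then show False using list_emb_length[of "(=)" "xs @ ys @ w # zs" \<alpha>] len assms by simp
  qed
  then show ?thesis by (auto simp: avoiders_def)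
qed

lemma fib_fps_mult_cong:
  "(\<And>j. j \<le> n \<Longrightarrow> A $ j = B $ j) \<Longrightarrow> (fib_fps m * A) $ n = (fib_fps m * B) $ n"
  unfolding fps_mult_nth by (intro sum.cong) auto

text \<open>With \<open>l = n - 1\<close> and \<open>d = 1\<close> the long patterns have length
  \<open>n + 1\<close>, so up to length \<open>n\<close> only 321 matters, and the recurrence at
  \<open>n\<close> has right-hand side 1. The Catalan numbers satisfy the same equations, and these
  determine a sequence.\<close>

lemma card_no321: "real (card {\<alpha> \<in> permutations_of_set {1..n}. no321 \<alpha>}) = catalan n"
proof (induction n rule: less_induct)
  case (less n)
  define c where "c n = real (card {\<alpha> \<in> permutations_of_set {1..n}. no321 \<alpha>})" for n
  have diag: "(fib_fps n * Abs_fps c) $ n = 1"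
  proof (cases "n < 2")
    case True
    have "{\<alpha> \<in> permutations_of_set {1..n}. no321 \<alpha>} = {[1..<Suc n]}"
      using True by (cases n) (auto simp: permutations_of_set_singleton no321_def less_Suc_eq split: if_splits)
    then have "c n = 1" by (simp add: c_def)
    moreover have "fib_fps n = 1" using True by (cases n) auto
    ultimately show ?thesis by simp
  next
    case False
    then have "(fib_fps n * Abs_fps c) $ n =
        (fib_fps n * Abs_fps (\<lambda>j. real (card (avoiders (n - 1) 1 j)))) $ n"
      by (intro fib_fps_mult_cong) (simp add: c_def avoiders_short)
    also have "\<dots> = 1" using avoiders_recurrence[of "n - 1" 1 n] False by simp
    finally show ?thesis .
  qed
  \<comment> \<open>The constant coefficient of \<open>fib_fps n\<close> is 1, so the
    \<open>n\<close>-th equation determines the \<open>n\<close>-th term from the earlier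
    ones.\<close>
  have split: "(fib_fps n * F) $ n = F $ n + (\<Sum>j = 1..n. fib_fps n $ j * F $ (n - j))" for F
    unfolding fps_mult_nth by (subst sum.atLeast_Suc_atMost) (simp_all add: fib_fps_nth)
  have "(\<Sum>j = 1..n. fib_fps n $ j * Abs_fps c $ (n - j)) =
      (\<Sum>j = 1..n. fib_fps n $ j * Abs_fps catalan $ (n - j))"
    using less by (intro sum.cong) (auto simp: c_def)
  then have "c n = catalan n"
    using diag fib_fps_mult_catalan_diag[of n] split[of "Abs_fps c"] split[of "Abs_fps catalan"] by simp
  then show ?case by (simp add: c_def)
qed

text \<open>From degree \<open>l + d\<close> on, the coefficients are the binomials of the
  recurrence and \<open>fib_fps (l + d - 1)\<close> contributes nothing. Below that degree the
  counts are Catalan numbers, and the product equals \<open>fib_fps (l + d - 1)\<close>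
  there.\<close>

lemma avoiders_gf:
  assumes "1 \<le> l" "1 \<le> d"
  shows "(fib_fps (l + d) * Abs_fps (\<lambda>n. real (card (avoiders l d n))) - fib_fps (l + d - 1)) *
    (1 - fps_X) ^ l = fps_X ^ (l + d)"
proof -
  let ?A = "Abs_fps (\<lambda>n. real (card (avoiders l d n)))"
  have "fib_fps (l + d) * ?A - fib_fps (l + d - 1) = fps_X ^ (l + d) * binomial_fps (l - 1)"
  proof (rule fps_ext)
    fix n
    show "(fib_fps (l + d) * ?A - fib_fps (l + d - 1)) $ n = (fps_X ^ (l + d) * binomial_fps (l - 1)) $ n"
    proof (cases "l + d \<le> n")
      case True
      moreover have "fib_fps (l + d - 1) $ n = 0"
        using True assms by (simp add: fib_fps_nth)
      moreover have "n - (l + d) + (l - 1) = n - d - 1" using True assms by simp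
      ultimately show ?thesis
        using avoiders_recurrence[OF assms] by (simp add: fps_X_power_mult_nth binomial_fps_def)
    next
      case False
      then have "(fib_fps (l + d) * ?A) $ n = (fib_fps (l + d) * Abs_fps catalan) $ n"
        by (intro fib_fps_mult_cong) (simp add: avoiders_short card_no321[simplified])
      then show ?thesis
        using False fib_fps_mult_catalan_below[of n "l + d"] by (simp add: fps_X_power_mult_nth)
    qed
  qed
  moreover have "binomial_fps (l - 1) * (1 - fps_X) ^ l = 1"
    using binomial_fps_mult[of "l - 1"] assms(1) by simp
  ultimately show ?thesis by (simp add: mult.assoc)
qed

section \<open>The three claims, with k = l + d + 1\<close>

theorem theorem3p1:
  fixes k d :: nat
  assumes "k \<ge> 3" and "1 \<le> d" and "d \<le> k - 2"
  shows "(\<forall>n\<ge>k. (\<Sum>j = 0..k - 1. (-1) ^ j * int ((k - 1 - j) choose j) * int (x1 k d (n - j)))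
                 = int ((n - d - 1) choose (k - d - 2)))
       \<and> (\<forall>n\<le>k - 1. real (x1 k d n) = 1 / (real n + 1) * real ((2 * n) choose n))
       \<and> (let s = (fls_X :: real fls) in
            fps_to_fls (fps_compose (x1_gf k d) (fps_X ^ 2))
            = (chebyshev_U_fls (k - 2) (1 / (2 * s)) + s ^ k / (1 - s ^ 2) ^ (k - d - 1))
              / (s * chebyshev_U_fls (k - 1) (1 / (2 * s))))"
proof -
  define l where "l = k - d - 1"
  have l: "1 \<le> l" "l + d = k - 1" "k - d - 2 = l - 1" using assms by (auto simp: l_def)
  have x1: "x1 k d n = card (avoiders l d n)" for n
    using x1_eq_card_avoiders[of d k n] assms by (simp add: l_def diff_commute)
  then have A: "x1_gf k d = Abs_fps (\<lambda>n. real (card (avoiders l d n)))" by (simp add: x1_gf_def)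
  have "(\<Sum>j = 0..k - 1. (-1) ^ j * int ((k - 1 - j) choose j) * int (x1 k d (n - j)))
      = int ((n - d - 1) choose (k - d - 2))" if "n \<ge> k" for n
  proof -
    have "(fib_fps (k - 1) * x1_gf k d) $ n = real ((n - d - 1) choose (k - d - 2))"
      using avoiders_recurrence[of l d n] l assms(2) that by (simp add: A)
    then have "(\<Sum>j = 0..k - 1. (-1) ^ j * real ((k - 1 - j) choose j) * real (x1 k d (n - j)))
        = real ((n - d - 1) choose (k - d - 2))"
      using that by (subst (asm) fib_fps_mult_nth) (simp_all add: x1_gf_def)
    \<comment> \<open>The power series have real coefficients, so the identity is transferred to the
      integers by injectivity of the embedding.\<close>
    then have "real_of_int (\<Sum>j = 0..k - 1. (-1) ^ j * int ((k - 1 - j) choose j) * int (x1 k d (n - j)))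
        = real_of_int (int ((n - d - 1) choose (k - d - 2)))"
      by simp
    then show ?thesis by (simp only: of_int_eq_iff)
  qed
  moreover have "real (x1 k d n) = 1 / (real n + 1) * real ((2 * n) choose n)" if "n \<le> k - 1" for n
    using card_no321[of n] that l by (simp add: x1 avoiders_short catalan_def)
  moreover have "fps_to_fls (fps_compose (x1_gf k d) (fps_X ^ 2))
            = (chebyshev_U_fls (k - 2) (1 / (2 * fls_X)) + fls_X ^ k / (1 - fls_X ^ 2) ^ (k - d - 1))
              / (fls_X * chebyshev_U_fls (k - 1) (1 / (2 * fls_X)))"
  proof -
    have k: "Suc (k - 2) = l + d" "k - 2 = l + d - 1" "k - 2 + 2 = k" "Suc (k - 2) = k - 1"
      using l assms by auto
    have "(fib_fps (Suc (k - 2)) * x1_gf k d - fib_fps (k - 2)) * (1 - fps_X) ^ l = fps_X ^ Suc (k - 2)"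
      using avoiders_gf[OF l(1) assms(2)] unfolding k(1) unfolding k(2) A .
    from gf_fls[OF this] show ?thesis
      by (simp only: k(3,4) sq_fls_def l_def)
  qed
  ultimately show ?thesis by (simp only: Let_def) blast
qed

end
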